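(* Let $0<\alpha,\beta<\infty$, let $u,v\in H(\mathbb{B})$, and let $\varphi,\psi:\mathbb{B}\to\mathbb{B}$ be holomorphic. Assume that at least one of the following two conditions holds: (A) there exists $C>0$ such that $$\inf_{a}\ \frac{1-|\varphi(a)|^2}{|1-\langle \varphi(a),\xi_a\rangle|}>C,\qquad \xi_a=\frac{\Phi_{\varphi(a)}(\psi(a))}{|\Phi_{\varphi(a)}(\psi(a))|};$$ (B) there exists $C>0$ such that $$\inf_{a}\ \frac{1-|\psi(a)|^2}{|1-\langle \psi(a),\zeta_a\rangle|}>C,\qquad \zeta_a=\frac{\Phi_{\psi(a)}(\varphi(a))}{|\Phi_{\psi(a)}(\varphi(a))|},$$ where both infima are over all $a\in\mathbb{B}$ with $\varphi(a)\neq\psi(a)$. Then $uC_\varphi-vC_\psi: H_\alpha^\infty\to H_\beta^\infty$ is bounded if and only if $$\sup_{j\in\mathbb{N}}\ \sup_{\xi\in\partial\mathbb{B}}\frac{\|u\langle\varphi,\xi\rangle^j-v\langle\psi,\xi\rangle^j\|_\beta}{\|\langle z,\xi\rangle^j\|_\alpha}<\infty$$ and $$\sup_{j\in\mathbb{N}}\ \sup_{\xi,\xi'\in\partial\mathbb{B}}\frac{\|u\langle\varphi,\xi\rangle^j\langle\varphi,\xi'\rangle-v\langle\psi,\xi\rangle^j\langle\psi,\xi'\rangle\|_\beta}{\|\langle z,\xi\rangle^j\langle z,\xi'\rangle\|_\alpha}<\infty.$$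
   Context: $\mathbb{B}$ is the open unit ball of $\mathbb{C}^n$ ($n\ge 1$), $\partial\mathbb{B}$ its boundary, $\langle\cdot,\cdot\rangle$ the standard Hermitian inner product (linear in the first variable), $H(\mathbb{B})$ the space of holomorphic functions $\mathbb{B}\to\mathbb{C}$. $\mathbb{N}=\{0,1,2,\dots\}$. For $a\in\mathbb{B}\setminus\{0\}$, $\Phi_a(z)=\dfrac{a-P_az-s_aQ_az}{1-\langle z,a\rangle}$, where $s_a=\sqrt{1-|a|^2}$, $P_az=\frac{\langle z,a\rangle}{\langle a,a\rangle}a$, $Q_az=z-P_az$; and $\Phi_0(z)=-z$. One has $\Phi_w(z)=0$ exactly when $z=w$. For $\gamma>0$ and $f\in H(\mathbb{B})$, $\|f\|_\gamma=\sup_{z\in\mathbb{B}}(1-|z|^2)^\gamma|f(z)|\in[0,\infty]$, and $H_\gamma^\infty=\{f\in H(\mathbb{B}):\|f\|_\gamma<\infty\}$, a Banach space under $\|\cdot\|_\gamma$. For $u\in H(\mathbb{B})$ and a holomorphic self-map $\varphi$ of $\mathbb{B}$, the weighted composition operator is $uC_\varphi f(z)=u(z)f(\varphi(z))$. $\langle\varphi,\xi\rangle$ denotes the function $z\mapsto\langle\varphi(z),\xi\rangle$; in denominators $\langle z,\xi\rangle$ denotes the function $z\mapsto\langle z,\xi\rangle$. *)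

theory Defs
  imports "HOL-Analysis.Analysis"
begin

text \<open>
  The space C^n is \<open>complex ^ 'n\<close>, whose library norm is the Euclidean one; the open unit ball is
  \<open>ball 0 1\<close> and its boundary is \<open>sphere 0 1\<close>.  Index types are nonempty, so n is at least 1.
  Functions on the ball are total functions of which only the values on the ball matter.
\<close>

text \<open>Linear in the first variable. The library's \<open>inner\<close> is only the real part of this.\<close>

definition hinner :: "complex ^ 'n \<Rightarrow> complex ^ 'n \<Rightarrow> complex" where
  "hinner z w = (\<Sum>i\<in>UNIV. z $ i * cnj (w $ i))"

text \<open>
  Holomorphy in several variables: complex Frechet differentiability at every point of an open
  set. \<open>has_derivative\<close> provides only a real-linear derivative, so complex homogeneity is demanded
  separately. (The library's \<open>holomorphic_on\<close> covers only functions of one complex variable.)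
\<close>

definition holomorphic_fun_on :: "(complex ^ 'n \<Rightarrow> complex) \<Rightarrow> (complex ^ 'n) set \<Rightarrow> bool" where
  "holomorphic_fun_on f S \<longleftrightarrow>
     (\<forall>z\<in>S. \<exists>D. (f has_derivative D) (at z) \<and> (\<forall>c h. D (c *s h) = c * D h))"

definition holomorphic_map_on ::
  "(complex ^ 'n \<Rightarrow> complex ^ 'm) \<Rightarrow> (complex ^ 'n) set \<Rightarrow> bool" where
  "holomorphic_map_on f S \<longleftrightarrow>
     (\<forall>z\<in>S. \<exists>D. (f has_derivative D) (at z) \<and> (\<forall>c h. D (c *s h) = c *s D h))"

definition Pproj :: "complex ^ 'n \<Rightarrow> complex ^ 'n \<Rightarrow> complex ^ 'n" where
  "Pproj a z = (hinner z a / hinner a a) *s a"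

definition Qproj :: "complex ^ 'n \<Rightarrow> complex ^ 'n \<Rightarrow> complex ^ 'n" where
  "Qproj a z = z - Pproj a z"

definition Phi :: "complex ^ 'n \<Rightarrow> complex ^ 'n \<Rightarrow> complex ^ 'n" where
  "Phi a z =
     (if a = 0 then - z
      else (1 / (1 - hinner z a)) *s
             (a - Pproj a z - sqrt (1 - (norm a)\<^sup>2) *\<^sub>R Qproj a z))"

definition Hnorm :: "real \<Rightarrow> (complex ^ 'n \<Rightarrow> complex) \<Rightarrow> ennreal" where
  "Hnorm \<gamma> f = (SUP z\<in>ball 0 1. ennreal ((1 - (norm z)\<^sup>2) powr \<gamma> * norm (f z)))"

definition Hinf :: "real \<Rightarrow> (complex ^ 'n \<Rightarrow> complex) set" where
  "Hinf \<gamma> = {f. holomorphic_fun_on f (ball 0 1) \<and> Hnorm \<gamma> f < \<infinity>}"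

definition wcomp ::
  "(complex ^ 'n \<Rightarrow> complex) \<Rightarrow> (complex ^ 'n \<Rightarrow> complex ^ 'n) \<Rightarrow>
   (complex ^ 'n \<Rightarrow> complex) \<Rightarrow> complex ^ 'n \<Rightarrow> complex" where
  "wcomp u \<phi> f = (\<lambda>z. u z * f (\<phi> z))"

text \<open>
  Boundedness of T between the two weighted spaces; linearity is not part of it, since the
  operators it is applied to are evidently linear.
\<close>

definition bounded_Hinf ::
  "real \<Rightarrow> real \<Rightarrow> ((complex ^ 'n \<Rightarrow> complex) \<Rightarrow> complex ^ 'n \<Rightarrow> complex) \<Rightarrow> bool" where
  "bounded_Hinf \<alpha> \<beta> T \<longleftrightarrow>
     (\<forall>f\<in>Hinf \<alpha>. T f \<in> Hinf \<beta>) \<and>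
     (\<exists>M\<ge>0. \<forall>f\<in>Hinf \<alpha>. Hnorm \<beta> (T f) \<le> ennreal M * Hnorm \<alpha> f)"

definition dirn ::
  "(complex ^ 'n \<Rightarrow> complex ^ 'n) \<Rightarrow> (complex ^ 'n \<Rightarrow> complex ^ 'n) \<Rightarrow>
   complex ^ 'n \<Rightarrow> complex ^ 'n" where
  "dirn \<phi> \<psi> a = Phi (\<phi> a) (\<psi> a) /\<^sub>R norm (Phi (\<phi> a) (\<psi> a))"

text \<open>
  The infimum is taken in the extended reals, so it is infinite (and the condition holds) if
  the two maps agree on the whole ball.
\<close>

definition inf_condition ::
  "(complex ^ 'n \<Rightarrow> complex ^ 'n) \<Rightarrow> (complex ^ 'n \<Rightarrow> complex ^ 'n) \<Rightarrow> bool" where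
  "inf_condition \<phi> \<psi> \<longleftrightarrow>
     (\<exists>C::real. C > 0 \<and>
        (INF a\<in>{a \<in> ball 0 1. \<phi> a \<noteq> \<psi> a}.
           ereal ((1 - (norm (\<phi> a))\<^sup>2) / norm (1 - hinner (\<phi> a) (dirn \<phi> \<psi> a)))) > ereal C)"

end

theory Submission
  imports Defs "HOL-Complex_Analysis.Conformal_Mappings"
begin

text \<open>
  The question is pointwise. For \<open>z\<close> in the ball put \<open>p = \<phi> z\<close>, \<open>q = \<psi> z\<close> and let \<open>U\<close>, \<open>V\<close> be
  the products of \<open>u z\<close>, \<open>v z\<close> with \<open>(1 - \<bar>z\<bar>\<^sup>2) powr \<beta>\<close>; the operator is bounded if and only if
  the functionals \<open>f \<mapsto> U f(p) - V f(q)\<close> are bounded on the source space uniformly in \<open>z\<close>.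
  Necessity of the two suprema follows by inserting monomials.

  For sufficiency, \<open>Hnorm_monomial_le\<close> turns the suprema into bounds of order
  \<open>(j + 1) powr -\<alpha>\<close> for the functional on monomials of degree \<open>j\<close>, and summing binomial series
  (\<open>kernel_functional_bound\<close>) turns these into bounds on the kernels \<open>(1 - \<langle>z,p\<rangle>) powr -N\<close>, also
  multiplied by one linear factor. The exponents \<open>N\<close> are integers above \<open>\<alpha>\<close>, so that
  only integer powers of complex numbers occur. Write \<open>\<delta> = 1 - \<bar>p\<bar>\<^sup>2\<close>, \<open>D = 1 - \<langle>q,p\<rangle>\<close> and
  \<open>\<rho> = \<bar>Phi p q\<bar>\<close>. The kernels give two things (\<open>test_kernel_consequences\<close>): a bound for
  \<open>U / \<delta>\<^sup>N - V / D\<^sup>N\<close>, and, using the infimum condition,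
  \<open>\<bar>V\<bar> \<rho> \<le> const (1 - \<bar>q\<bar>\<^sup>2) powr \<alpha>\<close>. Behind the second lies the identity
  \<open>\<rho>\<^sup>2 \<bar>D\<bar>\<^sup>2 = \<bar>\<langle>q-p,p\<rangle>\<bar>\<^sup>2 + \<delta> \<bar>q-p\<bar>\<^sup>2\<close> of \<open>norm_Phi\<close>.

  An arbitrary \<open>f\<close> is then compared with the multiple of the kernel that has the same value at \<open>p\<close>.
  The kernel part is controlled by the first bound. The difference vanishes at \<open>p\<close>, so by the
  Schwarz lemma on the complex line through \<open>p\<close> and \<open>q\<close> it is of order \<open>\<rho>\<close> at \<open>q\<close>
  (\<open>test_function_Lipschitz\<close>), and the second bound applies. The two alternative infimum conditions
  are exchanged by the symmetry between \<open>(p, U)\<close> and \<open>(q, V)\<close>.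
\<close>

section \<open>The Hermitian product\<close>

lemma hinner_diff_left: "hinner (x - y) w = hinner x w - hinner y w"
  by (simp add: hinner_def sum_subtractf algebra_simps)

lemma hinner_diff_right: "hinner w (x - y) = hinner w x - hinner w y"
  by (simp add: hinner_def sum_subtractf algebra_simps)

lemma hinner_add_left: "hinner (x + y) w = hinner x w + hinner y w"
  by (simp add: hinner_def sum.distrib algebra_simps)

lemma hinner_smult_left: "hinner (c *s x) w = c * hinner x w"
  by (simp add: hinner_def sum_distrib_left algebra_simps)

lemma hinner_smult_right: "hinner x (c *s w) = cnj c * hinner x w"
  by (simp add: hinner_def sum_distrib_left algebra_simps)

lemma scaleR_eq_smult: "r *\<^sub>R x = complex_of_real r *s (x :: complex ^ 'n)"
  by (simp add: vec_eq_iff) (simp add: scaleR_conv_of_real)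

lemma hinner_scaleR_right: "hinner x (r *\<^sub>R w) = of_real r * hinner x w"
  by (simp add: scaleR_eq_smult hinner_smult_right)

lemma hinner_zero_right [simp]: "hinner z 0 = 0"
  by (simp add: hinner_def)

lemma cnj_hinner: "cnj (hinner z w) = hinner w z"
  by (simp add: hinner_def mult.commute)

lemma hinner_self: "hinner z z = of_real ((norm z)\<^sup>2)"
proof -
  have "(norm z)\<^sup>2 = (\<Sum>i\<in>UNIV. (norm (z $ i))\<^sup>2)"
    by (simp add: norm_vec_def L2_set_def sum_nonneg)
  then show ?thesis
    by (simp add: hinner_def complex_norm_square del: of_real_power)
qed

lemma norm_hinner_le: "norm (hinner z w) \<le> norm z * norm w"
proof -
  have "norm (hinner z w) \<le> (\<Sum>i\<in>UNIV. \<bar>norm (z $ i)\<bar> * \<bar>norm (w $ i)\<bar>)"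
    unfolding hinner_def by (rule order_trans [OF norm_sum]) (simp add: norm_mult)
  also have "\<dots> \<le> norm z * norm w"
    unfolding norm_vec_def by (rule L2_set_mult_ineq)
  finally show ?thesis .
qed

lemma norm_diff_hinner_sq:
  "(norm (x - y))\<^sup>2 = (norm x)\<^sup>2 - 2 * Re (hinner x y) + (norm y)\<^sup>2"
proof -
  have "complex_of_real ((norm (x - y))\<^sup>2) = hinner (x - y) (x - y)"
    by (simp only: hinner_self)
  also have "\<dots> = hinner x x - (hinner x y + cnj (hinner x y)) + hinner y y"
    by (simp add: hinner_diff_left hinner_diff_right cnj_hinner)
  also have "\<dots> = complex_of_real ((norm x)\<^sup>2 - 2 * Re (hinner x y) + (norm y)\<^sup>2)"
    by (simp only: hinner_self complex_add_cnj) simp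
  finally show ?thesis
    by (simp only: of_real_eq_iff)
qed

lemma norm_smult: "norm (c *s x) = norm c * norm (x :: complex ^ 'n)"
  by (simp add: norm_vec_def norm_mult L2_set_right_distrib)

section \<open>The pseudohyperbolic distance\<close>

lemma one_minus_hinner_lower:
  assumes "norm p < 1" "norm q < 1"
  shows "1 - (norm p)\<^sup>2 \<le> 2 * norm (1 - hinner q p)"
proof -
  have "norm p * norm q \<le> norm p"
    using assms by (simp add: mult_left_le)
  then have "norm (hinner q p) \<le> norm p"
    using norm_hinner_le [of q p] by (simp add: mult.commute)
  then have "1 - norm p \<le> norm (1 - hinner q p)"
    using norm_triangle_ineq2 [of 1 "hinner q p"] by simp
  then have "2 * (1 - norm p) \<le> 2 * norm (1 - hinner q p)"
    by simp
  moreover have "1 - (norm p)\<^sup>2 \<le> 2 * (1 - norm p)"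
    using zero_le_power2 [of "1 - norm p"] by (simp add: power2_eq_square algebra_simps)
  ultimately show ?thesis by (rule order_trans [rotated])
qed

lemma norm_one_minus_hinner_commute: "norm (1 - hinner p q) = norm (1 - hinner q p)"
  by (metis cnj_hinner complex_cnj_diff complex_cnj_one complex_mod_cnj)

text \<open>
  The right-hand side is a Hermitian quadratic form in \<open>q - p\<close>, so the defect of the weights from
  \<open>\<bar>1 - \<langle>q,p\<rangle>\<bar>\<^sup>2\<close> scales by \<open>\<bar>\<lambda>\<bar>\<^sup>2\<close> when \<open>q\<close> moves to \<open>p + \<lambda> (q - p)\<close>.
\<close>

lemma defect_eq:
  "(norm (1 - hinner q p))\<^sup>2 - (1 - (norm p)\<^sup>2) * (1 - (norm q)\<^sup>2) =
     (norm (hinner (q - p) p))\<^sup>2 + (1 - (norm p)\<^sup>2) * (norm (q - p))\<^sup>2"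
proof -
  define h n m where "h = hinner q p" and "n = (norm p)\<^sup>2" and "m = (norm q)\<^sup>2"
  have "hinner (q - p) p = h - of_real n"
    by (simp only: hinner_diff_left hinner_self h_def n_def)
  moreover have "(norm (q - p))\<^sup>2 = m - 2 * Re h + n"
    by (simp add: norm_diff_hinner_sq h_def n_def m_def)
  moreover have "(norm (1 - h))\<^sup>2 - (1 - n) * (1 - m)
      = (norm (h - of_real n))\<^sup>2 + (1 - n) * (m - 2 * Re h + n)"
    unfolding cmod_power2 by (simp add: power2_eq_square algebra_simps)
  ultimately show ?thesis
    by (simp only: h_def n_def m_def)
qed

lemma hinner_Phi:
  assumes "hinner q p \<noteq> 1"
  shows "hinner (Phi p q) p = hinner (p - q) p / (1 - hinner q p)"
proof (cases "p = 0")
  case False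
  then have "hinner p p \<noteq> 0"
    by (simp add: hinner_self)
  then have "hinner (Qproj p q) p = 0" "hinner (Pproj p q) p = hinner q p"
    by (simp_all add: Qproj_def Pproj_def hinner_diff_left hinner_smult_left)
  then show ?thesis
    using False by (simp add: Phi_def hinner_smult_left hinner_diff_left scaleR_eq_smult
        diff_divide_distrib)
qed simp

text \<open>
  The components of \<open>Phi p q\<close> along \<open>p\<close> and orthogonal to it are handled separately by
  Pythagoras; the square root in the definition becomes the weight \<open>1 - \<bar>p\<bar>\<^sup>2\<close> of the second.
\<close>

lemma norm_Phi:
  assumes "norm p < 1" "hinner q p \<noteq> 1"
  shows "(norm (Phi p q))\<^sup>2 * (norm (1 - hinner q p))\<^sup>2 =
           (norm (hinner (q - p) p))\<^sup>2 + (1 - (norm p)\<^sup>2) * (norm (q - p))\<^sup>2"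
proof (cases "p = 0")
  case True
  then show ?thesis by (simp add: Phi_def)
next
  case False
  define s where "s = sqrt (1 - (norm p)\<^sup>2)"
  define n where "n = (norm p)\<^sup>2"
  define h where "h = hinner q p"
  define c where "c = h / of_real n"
  define x where "x = (1 - c) *s p"
  define y where "y = q - c *s p"
  have n: "n > 0" "n < 1"
    using False assms by (auto simp: n_def power_less_one_iff)
  have hpp: "hinner p p = of_real n"
    by (simp only: hinner_self n_def)
  have ss: "s\<^sup>2 = 1 - n"
    using n by (simp add: s_def n_def)
  have cn: "c * of_real n = h"
    using n by (simp add: c_def)
  have yp: "hinner y p = 0"
    by (simp add: y_def hinner_diff_left hinner_smult_left hpp cn flip: h_def)
  have xy: "hinner x (s *\<^sub>R y) = 0"
    using yp cnj_hinner [of y p]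
    by (simp add: x_def hinner_smult_left hinner_scaleR_right del: vector_sub_rdistrib)
  have Phi: "Phi p q = (1 / (1 - h)) *s (x - s *\<^sub>R y)"
    using False by (simp add: Phi_def x_def y_def s_def Pproj_def Qproj_def hpp h_def c_def)
  have nx: "(norm x)\<^sup>2 = (norm (1 - c))\<^sup>2 * n"
    by (simp add: x_def norm_smult power_mult_distrib n_def del: vector_sub_rdistrib)
  have "Re (hinner q (c *s p)) = (norm c)\<^sup>2 * n"
  proof -
    have "hinner q (c *s p) = cnj c * c * of_real n"
      by (simp add: hinner_smult_right cn flip: h_def)
    also have "\<dots> = of_real ((norm c)\<^sup>2 * n)"
      by (simp add: complex_norm_square mult.commute del: of_real_power)
    finally show ?thesis by simp
  qed
  then have ny: "(norm y)\<^sup>2 = (norm q)\<^sup>2 - (norm c)\<^sup>2 * n"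
    by (simp add: y_def norm_diff_hinner_sq norm_smult power_mult_distrib n_def)
  have "(norm (x - s *\<^sub>R y))\<^sup>2 = (norm x)\<^sup>2 + s\<^sup>2 * (norm y)\<^sup>2"
    by (simp add: norm_diff_hinner_sq xy power_mult_distrib)
  also have "\<dots> = (norm (1 - c))\<^sup>2 * n + (1 - n) * ((norm q)\<^sup>2 - (norm c)\<^sup>2 * n)"
    by (simp add: nx ny ss)
  also have "\<dots> = (norm (1 - c * of_real n))\<^sup>2 - (1 - n) * (1 - (norm q)\<^sup>2)"
    unfolding cmod_power2 by (simp add: power2_eq_square algebra_simps)
  also have "\<dots> = (norm (1 - h))\<^sup>2 - (1 - n) * (1 - (norm q)\<^sup>2)"
    by (simp only: cn)
  finally have "(norm (x - s *\<^sub>R y))\<^sup>2 = (norm (1 - h))\<^sup>2 - (1 - n) * (1 - (norm q)\<^sup>2)" .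
  moreover have "(norm (Phi p q))\<^sup>2 * (norm (1 - h))\<^sup>2 = (norm (x - s *\<^sub>R y))\<^sup>2"
    using assms by (simp add: Phi norm_smult norm_divide power_divide power_mult_distrib h_def
        del: vector_ssub_ldistrib)
  ultimately show ?thesis
    using defect_eq [of q p] by (simp add: h_def n_def)
qed

section \<open>Series with monomial decay\<close>

text \<open>
  With \<open>y = (j + 1) (1 - x)\<close> the left-hand side is at most \<open>y powr m * exp (1 - y)\<close>, because
  \<open>x \<le> exp (x - 1)\<close>. This serves twice: for the norms of monomials and for the summation of series.
\<close>

lemma power_weight_bound:
  fixes m :: real
  assumes "m \<ge> 0"
  obtains K where "K > 0"
    "\<And>(j::nat) x. \<lbrakk>0 \<le> x; x \<le> 1\<rbrakk> \<Longrightarrow> real (j + 1) powr m * (1 - x) powr m * x ^ j \<le> K"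
proof
  \<comment> \<open>The maximum is attained at \<open>y = m\<close>; using \<open>m + 1\<close> instead spares a separate case \<open>m = 0\<close>.\<close>
  define K where "K = (m + 1) powr m * exp 1"
  show "K > 0"
    using assms by (simp add: K_def)
  fix j :: nat and x :: real
  assume x: "0 \<le> x" "x \<le> 1"
  define y where "y = real (j + 1) * (1 - x)"
  have y: "y \<ge> 0"
    using x by (simp add: y_def)
  have "x \<le> exp (x - 1)"
    using exp_ge_add_one_self [of "x - 1"] by simp
  then have "x ^ j \<le> exp (x - 1) ^ j"
    using x by (intro power_mono) auto
  also have "\<dots> = exp (real j * (x - 1))"
    by (simp add: exp_of_nat_mult)
  also have "\<dots> \<le> exp (1 - y)"
    using x by (simp add: y_def algebra_simps)
  finally have xj: "x ^ j \<le> exp (1 - y)" .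
  have "y = (m + 1) * (y / (m + 1))"
    using assms by simp
  also have "\<dots> \<le> (m + 1) * exp (y / (m + 1))"
    using assms exp_ge_add_one_self [of "y / (m + 1)"]
    by (intro mult_left_mono order_trans [OF _ exp_ge_add_one_self]) auto
  finally have "y powr m \<le> ((m + 1) * exp (y / (m + 1))) powr m"
    using y assms by (intro powr_mono2) auto
  also have "\<dots> = (m + 1) powr m * exp (y / (m + 1) * m)"
    using assms by (subst powr_mult) (auto simp: powr_def)
  also have "y / (m + 1) * m \<le> y"
    using y assms by (simp add: field_simps)
  then have "(m + 1) powr m * exp (y / (m + 1) * m) \<le> (m + 1) powr m * exp y"
    by (intro mult_left_mono) auto
  finally have ym: "y powr m \<le> (m + 1) powr m * exp y" .
  have "real (j + 1) powr m * (1 - x) powr m * x ^ j = y powr m * x ^ j"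
    using x by (simp add: y_def powr_mult)
  also have "\<dots> \<le> ((m + 1) powr m * exp y) * exp (1 - y)"
    using ym xj x by (intro mult_mono) auto
  also have "\<dots> = K"
    by (simp add: K_def mult.assoc flip: exp_add)
  finally show "real (j + 1) powr m * (1 - x) powr m * x ^ j \<le> K" .
qed

lemma binomial_add_le_power: "(k + j choose k) \<le> (j + 1) ^ k"
proof (induction k)
  case (Suc k)
  have "Suc k * (Suc k + j choose Suc k) = Suc (k + j) * (k + j choose k)"
    using Suc_times_binomial [of k "k + j"] by simp
  also have "\<dots> \<le> (Suc k * (j + 1)) * (j + 1) ^ k"
    using Suc by (intro mult_mono) auto
  finally have "Suc k * (Suc k + j choose Suc k) \<le> Suc k * (j + 1) ^ Suc k"
    by (simp add: algebra_simps)
  then show ?case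
    by (simp only: Suc_mult_le_cancel1)
qed simp

lemma negative_binomial_sums:
  fixes z :: complex
  assumes "norm z < 1"
  shows "(\<lambda>j. of_nat (k + j choose k) * z ^ j) sums (1 / (1 - z) ^ Suc k)"
proof -
  have *: "(- of_nat (Suc k) gchoose j) * (- z) ^ j = of_nat (k + j choose k) * z ^ j" for j
  proof -
    have "(- of_nat (Suc k) gchoose j) = (- 1) ^ j * ((of_nat (k + j) :: complex) gchoose j)"
      by (subst gbinomial_minus) simp
    also have "(of_nat (k + j) :: complex) gchoose j = of_nat (k + j choose k)"
      using binomial_symmetric [of j "k + j"]
      by (simp flip: binomial_gbinomial del: of_nat_add)
    finally show ?thesis
      by (simp add: power_mult_distrib [symmetric] mult.commute mult.left_commute)
  qed
  have "1 + - z \<noteq> 0"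
    using assms by auto
  then have "(1 + - z) powr (- of_nat (Suc k)) = 1 / (1 - z) ^ Suc k"
    by (simp only: powr_minus powr_nat) (simp add: divide_inverse)
  then show ?thesis
    using gen_binomial_complex [of "- z" "- of_nat (Suc k)"] assms by (simp only: *) simp
qed

text \<open>
  The coefficients grow like \<open>j\<^sup>k\<close>, so the series behaves like the sum of \<open>j powr (k - \<alpha>) * t\<^sup>j\<close>,
  whose size is \<open>(1 - t) powr (\<alpha> - k - 1)\<close>. Splitting \<open>t\<^sup>j\<close> into two halves, one absorbs the power
  of \<open>j\<close> and the other one leaves a geometric series.
\<close>

lemma negative_binomial_series_bound:
  fixes \<alpha> :: real
  assumes "\<alpha> \<le> real k"
  obtains K where "K > 0"
    "\<And>(a :: nat \<Rightarrow> complex) s A t.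
       \<lbrakk>0 \<le> t; t < 1; A \<ge> 0; \<And>j. norm (a j) \<le> A * real (j + 1) powr - \<alpha> * t ^ j;
        (\<lambda>j. of_nat (k + j choose k) * a j) sums s\<rbrakk>
       \<Longrightarrow> norm s \<le> A * K * (1 - t\<^sup>2) powr (\<alpha> - real (Suc k))"
proof -
  define m where "m = real k - \<alpha>"
  have m: "m \<ge> 0"
    using assms by (simp add: m_def)
  obtain K where K: "K > 0"
    "\<And>(j::nat) x. \<lbrakk>0 \<le> x; x \<le> 1\<rbrakk> \<Longrightarrow> real (j + 1) powr m * (1 - x) powr m * x ^ j \<le> K"
    using power_weight_bound [OF m] by blast
  show ?thesis
  proof (rule that [of "K * 4 powr (m + 1)"])
    show "K * 4 powr (m + 1) > 0"
      using K by simp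
    fix a :: "nat \<Rightarrow> complex" and s A t
    assume t: "0 \<le> t" "t < 1" and A: "A \<ge> 0"
      and a: "\<And>j. norm (a j) \<le> A * real (j + 1) powr - \<alpha> * t ^ j"
      and s: "(\<lambda>j. of_nat (k + j choose k) * a j) sums s"
    define x where "x = sqrt t"
    have x: "0 \<le> x" "x < 1" "x * x = t"
      using t by (auto simp: x_def)
    have bd: "norm (of_nat (k + j choose k) * a j) \<le> A * K * (1 - x) powr - m * x ^ j" for j
    proof -
      have "real (k + j choose k) \<le> real (j + 1) ^ k"
        using binomial_add_le_power [of k j] by (metis of_nat_le_iff of_nat_power)
      then have "norm (of_nat (k + j choose k) * a j)
          \<le> real (j + 1) ^ k * (A * real (j + 1) powr - \<alpha> * t ^ j)"
        using a [of j] by (simp add: norm_mult mult_mono)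
      also have "real (j + 1) ^ k = real (j + 1) powr real k"
        by (simp add: powr_realpow)
      also have "real (j + 1) powr real k * (A * real (j + 1) powr - \<alpha> * t ^ j)
          = A * x ^ j * (real (j + 1) powr m * x ^ j)"
        by (simp add: m_def powr_diff powr_minus divide_inverse power_mult_distrib flip: x(3))
      also have "\<dots> \<le> A * x ^ j * (K * (1 - x) powr - m)"
        using K(2) [of x j] A x by (intro mult_left_mono) (auto simp: powr_minus field_simps)
      finally show ?thesis
        by (simp only: mult_ac)
    qed
    have "(\<lambda>j. A * K * (1 - x) powr - m * x ^ j) sums (A * K * (1 - x) powr - m * (1 / (1 - x)))"
      using x by (intro sums_mult geometric_sums) auto
    from norm_sums_le [OF s this] bd
    have "norm s \<le> A * K * (1 - x) powr - m * (1 / (1 - x))"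
      by blast
    also have "\<dots> = A * K * (1 - x) powr - (m + 1)"
      using x by (simp add: powr_diff powr_minus_divide powr_add)
    also have "\<dots> \<le> A * K * ((1 - t\<^sup>2) / 4) powr - (m + 1)"
    proof -
      have "1 - t\<^sup>2 = (1 - x) * ((1 + x) * (1 + x * x))"
        by (simp add: power2_eq_square algebra_simps flip: x(3))
      also have "\<dots> \<le> (1 - x) * (2 * 2)"
        using x t by (intro mult_left_mono mult_mono) auto
      finally have "(1 - t\<^sup>2) / 4 \<le> 1 - x" by simp
      moreover have "0 < 1 - t\<^sup>2"
        using t by (simp add: power_less_one_iff)
      ultimately show ?thesis
        using A K m by (intro mult_left_mono powr_mono2') auto
    qed
    also have "\<dots> = A * (K * 4 powr (m + 1)) * (1 - t\<^sup>2) powr (\<alpha> - real (Suc k))"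
    proof -
      have "0 < 1 - t\<^sup>2"
        using t by (simp add: power_less_one_iff)
      then show ?thesis
        by (simp add: powr_divide m_def powr_minus field_simps powr_diff powr_add)
    qed
    finally show "norm s \<le> A * (K * 4 powr (m + 1)) * (1 - t\<^sup>2) powr (\<alpha> - real (Suc k))" .
  qed
qed

section \<open>Lipschitz estimate along complex lines\<close>

lemma holomorphic_fun_on_line:
  assumes f: "holomorphic_fun_on f S" and "\<And>l. l \<in> T \<Longrightarrow> p + l *s d \<in> S" and "open T"
  shows "(\<lambda>l. f (p + l *s d)) holomorphic_on T"
  unfolding holomorphic_on_open [OF \<open>open T\<close>]
proof
  fix l assume "l \<in> T"
  then obtain D where D: "(f has_derivative D) (at (p + l *s d))" "\<And>c h. D (c *s h) = c * D h"
    using f assms(2) unfolding holomorphic_fun_on_def by blast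
  have "linear (\<lambda>h::complex. h *s d)"
    by (intro linearI) (simp_all add: vec_eq_iff)
  then have "bounded_linear (\<lambda>h::complex. h *s d)"
    by (rule linear_conv_bounded_linear [THEN iffD1])
  then have "((\<lambda>l. p + l *s d) has_derivative (\<lambda>h. h *s d)) (at l)"
    by (auto intro!: derivative_eq_intros bounded_linear_imp_has_derivative)
  from has_derivative_compose [OF this D(1)]
  have "((\<lambda>l. f (p + l *s d)) has_derivative (\<lambda>h. D d * h)) (at l)"
    by (simp add: D(2) mult.commute)
  then show "\<exists>f'. ((\<lambda>l. f (p + l *s d)) has_field_derivative f') (at l)"
    unfolding has_field_derivative_def by blast
qed

lemma Schwarz_Lemma_scaled:
  fixes g :: "complex \<Rightarrow> complex"
  assumes g: "g holomorphic_on ball 0 R" and "g 0 = 0" and R: "R > 1"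
    and B: "\<And>l. norm l < R \<Longrightarrow> norm (g l) \<le> B"
  shows "norm (g 1) \<le> 2 * B / R"
proof (cases "B > 0")
  case False
  then show ?thesis
    using B [of 1] R by (smt (verit) norm_ge_zero norm_one divide_eq_0_iff)
next
  case True
  \<comment> \<open>The factor 2 makes the bound strict, as the Schwarz lemma demands.\<close>
  define k where "k = (\<lambda>l. g (of_real R * l) / of_real (2 * B))"
  have "(g \<circ> (\<lambda>l. of_real R * l)) holomorphic_on ball 0 1"
    using R by (intro holomorphic_on_compose_gen [OF _ g] holomorphic_intros)
      (auto simp: norm_mult)
  then have 1: "k holomorphic_on ball 0 1"
    unfolding k_def using True by (intro holomorphic_intros) (auto simp: o_def)
  have 2: "norm (k l) < 1" if "norm l < 1" for l
  proof -
    have "norm (g (of_real R * l)) \<le> B"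
      using R that by (intro B) (simp add: norm_mult)
    also have "B < 2 * B"
      using True by simp
    finally show ?thesis
      using True by (simp add: k_def norm_divide)
  qed
  have "norm (k (1 / of_real R)) \<le> norm (1 / of_real R :: complex)"
    using R \<open>g 0 = 0\<close> by (intro Schwarz_Lemma(1) [OF 1 _ 2]) (auto simp: k_def norm_divide)
  then show ?thesis
    using R True by (simp add: k_def norm_divide field_simps)
qed

lemma weight_le_product:
  assumes p: "norm p < 1" and q: "norm q < 1" and \<alpha>: "0 \<le> \<alpha>" "\<alpha> \<le> real N"
  shows "(1 - (norm p)\<^sup>2) powr (real N - \<alpha>) * (1 - (norm q)\<^sup>2) powr \<alpha>
           \<le> 2 ^ N * norm (1 - hinner q p) ^ N"
proof -
  have 0: "0 < 1 - (norm p)\<^sup>2" "0 < 1 - (norm q)\<^sup>2"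
    using p q by (simp_all add: power_less_one_iff)
  then have D: "norm (1 - hinner q p) > 0"
    using one_minus_hinner_lower [OF p q] by linarith
  have "(1 - (norm p)\<^sup>2) powr (real N - \<alpha>) * (1 - (norm q)\<^sup>2) powr \<alpha>
     \<le> (2 * norm (1 - hinner q p)) powr (real N - \<alpha>) * (2 * norm (1 - hinner q p)) powr \<alpha>"
    using 0 \<alpha> one_minus_hinner_lower [OF p q] one_minus_hinner_lower [OF q p]
    by (intro mult_mono powr_mono2) (auto simp: norm_one_minus_hinner_commute)
  also have "\<dots> = (2 * norm (1 - hinner q p)) ^ N"
    using D by (subst powr_add [symmetric]) (simp add: powr_realpow)
  finally show ?thesis
    by (simp add: power_mult_distrib)
qed

text \<open>
  If \<open>r = \<bar>Phi p q\<bar>\<close> is small, the complex line through \<open>p\<close> and \<open>q\<close> keeps at least half of the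
  weight \<open>\<delta> = 1 - \<bar>p\<bar>\<^sup>2\<close> for all parameters of modulus at most \<open>1 / (8 r)\<close>: there the linear form
  \<open>\<langle>z-p,p\<rangle>\<close> is at most \<open>\<delta> / 4\<close> and the quadratic form of \<open>defect_eq\<close> is at most \<open>\<delta>\<^sup>2 / 16\<close>.
  The disc is large compared with the parameter 1 of \<open>q\<close>, which gives the Schwarz lemma its
  factor \<open>r\<close>.
\<close>

lemma line_in_comparable_region:
  assumes p: "norm p < 1" and q: "norm q < 1"
    and r: "r > 0" "r \<le> 1/16" and l: "norm l \<le> 1 / (8 * r)"
    and rho: "r\<^sup>2 * (norm (1 - hinner q p))\<^sup>2 =
           (norm (hinner (q - p) p))\<^sup>2 + (1 - (norm p)\<^sup>2) * (norm (q - p))\<^sup>2"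
  defines "z \<equiv> p + l *s (q - p)"
  shows "norm (1 - hinner z p) \<ge> 3/4 * (1 - (norm p)\<^sup>2)"
    and "1 - (norm z)\<^sup>2 \<ge> (1 - (norm p)\<^sup>2) / 2"
    and "norm (1 - hinner q p) \<le> 2 * (1 - (norm p)\<^sup>2)"
proof -
  define d where "d = 1 - (norm p)\<^sup>2"
  define h where "h = hinner (q - p) p"
  define D where "D = norm (1 - hinner q p)"
  have d: "d > 0"
    using p by (simp add: d_def power_less_one_iff)
  have D0: "D \<ge> 0" by (simp add: D_def)
  have "(norm h)\<^sup>2 \<le> (r * D)\<^sup>2"
    using rho d by (simp add: d_def h_def D_def power_mult_distrib)
  then have h: "norm h \<le> r * D"
    using r D0 by (simp add: power2_le_iff_abs_le)
  have "1 - hinner q p = of_real d - h"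
    by (simp add: h_def d_def hinner_diff_left hinner_self)
  then have "D \<le> norm (of_real d :: complex) + norm h"
    unfolding D_def by (metis norm_triangle_ineq4)
  then have "D \<le> d + r * D"
    using h d by simp
  moreover have "r * D \<le> 1/16 * D"
    using r D0 by (intro mult_right_mono) auto
  ultimately have D: "D \<le> 2 * d"
    using D0 by linarith
  then show "norm (1 - hinner q p) \<le> 2 * (1 - (norm p)\<^sup>2)"
    by (simp add: D_def d_def)
  have "norm (l * h) \<le> 1 / (8 * r) * (r * (2 * d))"
    unfolding norm_mult using l h D r D0
    by (intro mult_mono) (auto intro: order_trans [OF h])
  also have "\<dots> = d / 4"
    using r by simp
  finally have lh: "norm (l * h) \<le> d / 4" .
  have z: "1 - hinner z p = of_real d - l * h"
    by (simp add: z_def d_def h_def hinner_add_left hinner_smult_left hinner_self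
        del: vector_ssub_ldistrib)
  then have "d - d / 4 \<le> norm (1 - hinner z p)"
    using lh d norm_triangle_ineq2 [of "of_real d" "l * h"] by simp
  then show 1: "norm (1 - hinner z p) \<ge> 3/4 * (1 - (norm p)\<^sup>2)"
    by (simp flip: d_def)
  have zp: "z - p = l *s (q - p)"
    by (simp add: z_def)
  have "(norm (1 - hinner z p))\<^sup>2 - d * (1 - (norm z)\<^sup>2)
      = (norm (l * h))\<^sup>2 + d * (norm l * norm (q - p))\<^sup>2"
    unfolding d_def defect_eq [of z p] zp hinner_smult_left norm_smult h_def ..
  also have "\<dots> = (norm l)\<^sup>2 * (r\<^sup>2 * D\<^sup>2)"
    unfolding D_def rho by (simp add: norm_mult power_mult_distrib distrib_left h_def d_def)
  also have "\<dots> = (norm l * r * D)\<^sup>2"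
    by (simp add: power_mult_distrib)
  also have "\<dots> \<le> (1/8 * (2 * d))\<^sup>2"
    using l r D D0 by (intro power_mono mult_mono) (auto simp: field_simps)
  finally have "(norm (1 - hinner z p))\<^sup>2 - d\<^sup>2 / 16 \<le> d * (1 - (norm z)\<^sup>2)"
    by (simp add: power_mult_distrib power2_eq_square)
  moreover have "(3/4 * d)\<^sup>2 \<le> (norm (1 - hinner z p))\<^sup>2"
    using 1 d by (intro power_mono) (auto simp: d_def)
  ultimately have "d * (d / 2) \<le> d * (1 - (norm z)\<^sup>2)"
    by (simp add: power_mult_distrib power2_eq_square)
  then show "1 - (norm z)\<^sup>2 \<ge> (1 - (norm p)\<^sup>2) / 2"
    using d by (simp flip: d_def)
qed

text \<open>
  Read as a function of \<open>q\<close>, the difference between \<open>f\<close> and the multiple of the kernel with the same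
  value at \<open>p\<close> vanishes at \<open>p\<close>. For \<open>r > 1/16\<close> the trivial bound suffices; otherwise the Schwarz
  lemma is applied on the complex line through \<open>p\<close> and \<open>q\<close>.
\<close>

lemma test_function_Lipschitz:
  assumes \<alpha>: "0 < \<alpha>" "\<alpha> \<le> real N"
  obtains K where "K > 0"
    "\<And>(p :: complex ^ 'n) q r f M.
      \<lbrakk>norm p < 1; norm q < 1; r \<ge> 0;
       r\<^sup>2 * (norm (1 - hinner q p))\<^sup>2 =
           (norm (hinner (q - p) p))\<^sup>2 + (1 - (norm p)\<^sup>2) * (norm (q - p))\<^sup>2;
       holomorphic_fun_on f (ball 0 1);
       \<And>z. norm z < 1 \<Longrightarrow> norm (f z) \<le> M * (1 - (norm z)\<^sup>2) powr - \<alpha>; M \<ge> 0\<rbrakk>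
      \<Longrightarrow> norm (of_real (1 - (norm p)\<^sup>2) ^ N * f p / (1 - hinner q p) ^ N - f q)
            \<le> K * r * (1 - (norm q)\<^sup>2) powr - \<alpha> * M"
proof -
  \<comment> \<open>The first entry is for \<open>r > 1/16\<close>, the second one for \<open>r \<le> 1/16\<close>.\<close>
  define K where "K = max (16 * (2 ^ N + 1)) (16 * ((4/3) ^ N + 2 powr \<alpha>) * 4 powr \<alpha>)"
  have K0: "16 * (2 ^ N + 1) \<le> K" "16 * ((4/3) ^ N + 2 powr \<alpha>) * 4 powr \<alpha> \<le> K"
    by (simp_all add: K_def)
  show ?thesis
  proof (rule that [of K])
    show "K > 0"
      using K0(1) by (rule less_le_trans [rotated]) (simp add: add_pos_pos)
    fix p q :: "complex ^ 'n" and r M and f :: "complex ^ 'n \<Rightarrow> complex"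
    assume p: "norm p < 1" and q: "norm q < 1" and r: "r \<ge> 0"
      and rho: "r\<^sup>2 * (norm (1 - hinner q p))\<^sup>2 =
           (norm (hinner (q - p) p))\<^sup>2 + (1 - (norm p)\<^sup>2) * (norm (q - p))\<^sup>2"
      and f: "holomorphic_fun_on f (ball 0 1)"
      and fM: "\<And>z. norm z < 1 \<Longrightarrow> norm (f z) \<le> M * (1 - (norm z)\<^sup>2) powr - \<alpha>"
      and M: "M \<ge> 0"
    define d e where "d = 1 - (norm p)\<^sup>2" and "e = 1 - (norm q)\<^sup>2"
    define D where "D = norm (1 - hinner q p)"
    have d: "d > 0" "e > 0"
      using p q by (simp_all add: d_def e_def power_less_one_iff)
    have "d \<le> 2 * D"
      using one_minus_hinner_lower [OF p q] by (simp only: D_def d_def)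
    then have D0: "D > 0"
      using d by linarith
    have dp: "1 - hinner p p = of_real d"
      by (simp add: hinner_self d_def)
    define k where "k = (\<lambda>z. of_real d ^ N * f p / (1 - hinner z p) ^ N - f z)"
    have "d ^ N * d powr - \<alpha> = d powr (real N - \<alpha>)"
      using d by (simp add: powr_diff powr_minus_divide powr_realpow)
    then have dfp: "norm (of_real d ^ N * f p) \<le> d powr (real N - \<alpha>) * M"
      using mult_left_mono [OF fM [OF p], of "d ^ N"] d
      by (simp add: norm_mult norm_power mult_ac flip: d_def)
    consider "r > 1/16" | "r = 0" | "0 < r" "r \<le> 1/16"
      using r by linarith
    then have "norm (k q) \<le> K * r * e powr - \<alpha> * M"
    proof cases
      case 1
      have "norm (k q) \<le> norm (of_real d ^ N * f p / (1 - hinner q p) ^ N) + norm (f q)"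
        unfolding k_def by (rule norm_triangle_ineq4)
      also have "\<dots> \<le> d powr (real N - \<alpha>) * M / D ^ N + M * e powr - \<alpha>"
        using dfp fM [OF q] D0
        by (intro add_mono) (simp_all add: norm_divide norm_power divide_right_mono D_def e_def)
      also have "d powr (real N - \<alpha>) / D ^ N \<le> 2 ^ N * e powr - \<alpha>"
        using weight_le_product [OF p q, of \<alpha> N] \<alpha> D0 d
        by (simp add: powr_minus_divide field_simps d_def e_def D_def)
      then have "d powr (real N - \<alpha>) * M / D ^ N + M * e powr - \<alpha>
          \<le> (2 ^ N + 1) * e powr - \<alpha> * M"
        using M mult_right_mono [of "d powr (real N - \<alpha>) / D ^ N" "2 ^ N * e powr - \<alpha>" M]
        by (simp add: algebra_simps)
      also have "\<dots> \<le> (K * r) * e powr - \<alpha> * M"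
      proof -
        have "2 ^ N + 1 \<le> 16 * (2 ^ N + 1) * r"
          using 1 mult_left_mono [of 1 "16 * r" "2 ^ N + 1 :: real"] by (simp add: mult_ac)
        also have "\<dots> \<le> K * r"
          using K0(1) r by (intro mult_right_mono) auto
        finally show ?thesis
          using M by (intro mult_right_mono) auto
      qed
      finally show ?thesis .
    next
      case 2
      then have "(norm (q - p))\<^sup>2 * d = 0"
        using rho d by (simp add: add_nonneg_eq_0_iff mult.commute flip: d_def)
      then have "q = p"
        using d by simp
      then have "k q = 0"
        using d by (simp add: k_def dp)
      then show ?thesis
        using 2 by simp
    next
      case 3
      define R where "R = 1 / (8 * r)"
      have R: "R > 1"
        using 3 by (simp add: R_def field_simps)
      define B where "B = ((4/3) ^ N + 2 powr \<alpha>) * d powr - \<alpha> * M"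
      have line: "norm (1 - hinner (p + l *s (q - p)) p) \<ge> 3/4 * d"
        "1 - (norm (p + l *s (q - p)))\<^sup>2 \<ge> d / 2"
        if "norm l < R" for l
        using line_in_comparable_region [OF p q 3, of l] rho that by (simp_all add: R_def d_def)
      have D2: "D \<le> 2 * d"
        using line_in_comparable_region(3) [OF p q 3, of 0] rho 3 by (simp add: D_def d_def)
      have inball: "norm (p + l *s (q - p)) < 1" if "norm l < R" for l
      proof -
        have "0 < 1 - (norm (p + l *s (q - p)))\<^sup>2"
          using line(2) [OF that] d by linarith
        then show ?thesis
          by (simp add: abs_square_less_1)
      qed
      have den: "1 - hinner (p + l *s (q - p)) p \<noteq> 0" if "norm l < R" for l
        using line(1) [OF that] d by auto
      have hol: "(\<lambda>l. k (p + l *s (q - p))) holomorphic_on ball 0 R"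
      proof -
        have "(\<lambda>l. f (p + l *s (q - p))) holomorphic_on ball 0 R"
          using inball by (intro holomorphic_fun_on_line [OF f]) auto
        moreover have "(\<lambda>l. hinner (p + l *s (q - p)) p) holomorphic_on ball 0 R"
          unfolding hinner_add_left hinner_smult_left by (intro holomorphic_intros)
        ultimately show ?thesis
          unfolding k_def using den
          by (intro holomorphic_on_diff holomorphic_on_divide holomorphic_on_power
              holomorphic_on_const) auto
      qed
      have bd: "norm (k (p + l *s (q - p))) \<le> B" if l: "norm l < R" for l
      proof -
        let ?z = "p + l *s (q - p)"
        have "norm (k ?z) \<le> norm (of_real d ^ N * f p / (1 - hinner ?z p) ^ N) + norm (f ?z)"
          unfolding k_def by (rule norm_triangle_ineq4)
        also have "\<dots> \<le> d powr (real N - \<alpha>) * M / (3/4 * d) ^ N + M * (d / 2) powr - \<alpha>"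
        proof (rule add_mono)
          show "norm (of_real d ^ N * f p / (1 - hinner ?z p) ^ N)
              \<le> d powr (real N - \<alpha>) * M / (3/4 * d) ^ N"
            unfolding norm_divide norm_power using line(1) [OF l] d dfp
            by (intro frac_le power_mono) (auto simp: M)
          have "norm (f ?z) \<le> M * (1 - (norm ?z)\<^sup>2) powr - \<alpha>"
            by (rule fM [OF inball [OF l]])
          also have "\<dots> \<le> M * (d / 2) powr - \<alpha>"
            using line(2) [OF l] d \<alpha> M by (intro mult_left_mono powr_mono2') auto
          finally show "norm (f ?z) \<le> M * (d / 2) powr - \<alpha>" .
        qed
        also have "\<dots> = B"
          using d by (simp add: B_def powr_diff powr_minus_divide powr_realpow powr_divide
              field_simps)
        finally show ?thesis .
      qed
      have k0: "k p = 0"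
        using d by (simp add: k_def dp)
      have "norm (k q) \<le> 2 * B / R"
        using Schwarz_Lemma_scaled [OF hol _ R bd] k0 by simp
      also have "\<dots> = 16 * ((4/3) ^ N + 2 powr \<alpha>) * r * d powr - \<alpha> * M"
        using 3 by (simp add: R_def B_def)
      also have "\<dots> \<le> 16 * ((4/3) ^ N + 2 powr \<alpha>) * r * (4 powr \<alpha> * e powr - \<alpha>) * M"
      proof -
        have "d * e \<le> D\<^sup>2"
          using defect_eq [of q p] d zero_le_power2 [of "norm (hinner (q - p) p)"]
          by (simp add: d_def e_def D_def)
            (smt (verit) mult_nonneg_nonneg zero_le_power2)
        also have "\<dots> \<le> (2 * d)\<^sup>2"
          using D2 D0 by (intro power_mono) auto
        finally have "d * e \<le> d * (4 * d)"
          by (simp add: power2_eq_square)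
        then have "e / 4 \<le> d"
          using d by simp
        then have "d powr - \<alpha> \<le> (e / 4) powr - \<alpha>"
          using d \<alpha> by (intro powr_mono2') auto
        also have "\<dots> = 4 powr \<alpha> * e powr - \<alpha>"
          using d by (simp add: powr_divide powr_minus_divide)
        finally show ?thesis
          using M r by (intro mult_right_mono mult_left_mono) auto
      qed
      also have "\<dots> = 16 * ((4/3) ^ N + 2 powr \<alpha>) * 4 powr \<alpha> * (r * e powr - \<alpha> * M)"
        by simp
      also have "\<dots> \<le> K * (r * e powr - \<alpha> * M)"
        using K0(2) M r by (intro mult_right_mono) auto
      finally show ?thesis
        by (simp add: mult_ac)
    qed
    then show "norm (of_real (1 - (norm p)\<^sup>2) ^ N * f p / (1 - hinner q p) ^ N - f q)
            \<le> K * r * (1 - (norm q)\<^sup>2) powr - \<alpha> * M"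
      by (simp add: k_def d_def e_def)
  qed
qed

section \<open>Functionals supported on two points\<close>

text \<open>
  Boundedness of the operator concerns, at each point of the ball, a functional
  \<open>f \<mapsto> U f(p) - V f(q)\<close>. The predicate below records what the two suprema say about it; the
  vectors \<open>w\<close> and \<open>\<eta>\<close> need not be unit vectors, so that power series can be summed.
\<close>

definition monomial_control ::
  "real \<Rightarrow> real \<Rightarrow> complex ^ 'n \<Rightarrow> complex ^ 'n \<Rightarrow> complex \<Rightarrow> complex \<Rightarrow> bool" where
  "monomial_control \<alpha> A p q U V \<longleftrightarrow>
     (\<forall>j w. norm (U * hinner p w ^ j - V * hinner q w ^ j)
        \<le> A * real (j + 1) powr - \<alpha> * norm w ^ j) \<and>
     (\<forall>j w \<eta>. norm (U * hinner p w ^ j * hinner p \<eta> - V * hinner q w ^ j * hinner q \<eta>)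
        \<le> A * real (j + 1) powr - \<alpha> * norm w ^ j * norm \<eta>)"

lemma monomial_control_swap:
  "monomial_control \<alpha> A p q U V \<Longrightarrow> monomial_control \<alpha> A q p V U"
  unfolding monomial_control_def by (metis norm_minus_commute)

lemma kernel_functional_bound:
  fixes \<alpha> :: real
  assumes "\<alpha> \<le> real k"
  obtains K where "K > 0"
    "\<And>U V x y A t.
       \<lbrakk>0 \<le> t; t < 1; A \<ge> 0; norm x < 1; norm y < 1;
        \<And>j. norm (U * x ^ j - V * y ^ j) \<le> A * real (j + 1) powr - \<alpha> * t ^ j\<rbrakk>
       \<Longrightarrow> norm (U / (1 - x) ^ Suc k - V / (1 - y) ^ Suc k :: complex)
             \<le> A * K * (1 - t\<^sup>2) powr (\<alpha> - real (Suc k))"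
proof -
  obtain K where K: "K > 0" and
    bd: "\<And>(a :: nat \<Rightarrow> complex) s A t.
       \<lbrakk>0 \<le> t; t < 1; A \<ge> 0; \<And>j. norm (a j) \<le> A * real (j + 1) powr - \<alpha> * t ^ j;
        (\<lambda>j. of_nat (k + j choose k) * a j) sums s\<rbrakk>
       \<Longrightarrow> norm s \<le> A * K * (1 - t\<^sup>2) powr (\<alpha> - real (Suc k))"
    using negative_binomial_series_bound [OF assms] by blast
  show ?thesis
  proof (rule that [OF K])
    fix U V x y :: complex and A t :: real
    assume *: "0 \<le> t" "t < 1" "A \<ge> 0"
      "\<And>j. norm (U * x ^ j - V * y ^ j) \<le> A * real (j + 1) powr - \<alpha> * t ^ j"
      and x: "norm x < 1" and y: "norm y < 1"
    have "(\<lambda>j. of_nat (k + j choose k) * (U * x ^ j - V * y ^ j)) sums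
        (U * (1 / (1 - x) ^ Suc k) - V * (1 / (1 - y) ^ Suc k))"
      using sums_diff [OF sums_mult [OF negative_binomial_sums [OF x, of k], of U]
          sums_mult [OF negative_binomial_sums [OF y, of k], of V]]
      by (simp only: right_diff_distrib mult.left_commute)
    from bd [OF * this] show "norm (U / (1 - x) ^ Suc k - V / (1 - y) ^ Suc k)
        \<le> A * K * (1 - t\<^sup>2) powr (\<alpha> - real (Suc k))"
      by simp
  qed
qed

text \<open>
  The functional is tested on the kernels \<open>(1 - \<langle>z,p\<rangle>) powr -N\<close>, \<open>(1 - \<langle>z,p\<rangle>) powr -(N+1)\<close> and
  \<open>\<langle>z,p-q\<rangle> (1 - \<langle>z,p\<rangle>) powr -(N+1)\<close> with \<open>N = k + 1\<close>. Suitable combinations of them vanish at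
  \<open>p\<close>, so they bound the products of \<open>V\<close> with \<open>\<bar>\<langle>q-p,p\<rangle>\<bar>\<close> and with \<open>\<delta> \<bar>q-p\<bar>\<close>, where
  \<open>\<delta> = 1 - \<bar>p\<bar>\<^sup>2\<close>. By \<open>norm_Phi\<close> one would need \<open>sqrt \<delta> \<bar>q-p\<bar>\<close> instead of \<open>\<delta> \<bar>q-p\<bar>\<close>, and the
  infimum condition makes up for this factor: it forces \<open>Phi p q\<close> to be so close to the direction of
  \<open>p\<close> that \<open>\<bar>q-p\<bar>\<close> is at most a multiple of \<open>\<bar>Phi p q\<bar> \<bar>1 - \<langle>q,p\<rangle>\<bar>\<close>.
\<close>

lemma test_kernel_consequences:
  fixes \<alpha> C :: real
  assumes "0 < \<alpha>" and k: "\<alpha> \<le> real k" and C: "C > 0"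
  obtains K where "K > 0"
    "\<And>(p :: complex ^ 'n) q U V A.
      \<lbrakk>norm p < 1; norm q < 1; A \<ge> 0; monomial_control \<alpha> A p q U V;
       p \<noteq> q \<Longrightarrow> C * norm (1 - hinner p (Phi p q /\<^sub>R norm (Phi p q))) \<le> 1 - (norm p)\<^sup>2\<rbrakk>
      \<Longrightarrow> norm (U / of_real (1 - (norm p)\<^sup>2) ^ Suc k - V / (1 - hinner q p) ^ Suc k)
             \<le> K * A * (1 - (norm p)\<^sup>2) powr (\<alpha> - real (Suc k)) \<and>
          norm V * norm (Phi p q) \<le> K * A * (1 - (norm q)\<^sup>2) powr \<alpha>"
proof -
  obtain K1 where K1: "K1 > 0" and bd1: "\<And>U V x y A t.
       \<lbrakk>0 \<le> t; t < 1; A \<ge> 0; norm x < 1; norm y < 1;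
        \<And>j. norm (U * x ^ j - V * y ^ j) \<le> A * real (j + 1) powr - \<alpha> * t ^ j\<rbrakk>
       \<Longrightarrow> norm (U / (1 - x) ^ Suc k - V / (1 - y) ^ Suc k :: complex)
             \<le> A * K1 * (1 - t\<^sup>2) powr (\<alpha> - real (Suc k))"
    using kernel_functional_bound [OF k] by blast
  have k': "\<alpha> \<le> real (Suc k)"
    using k by simp
  obtain K2 where K2: "K2 > 0" and bd2: "\<And>U V x y A t.
       \<lbrakk>0 \<le> t; t < 1; A \<ge> 0; norm x < 1; norm y < 1;
        \<And>j. norm (U * x ^ j - V * y ^ j) \<le> A * real (j + 1) powr - \<alpha> * t ^ j\<rbrakk>
       \<Longrightarrow> norm (U / (1 - x) ^ Suc (Suc k) - V / (1 - y) ^ Suc (Suc k) :: complex)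
             \<le> A * K2 * (1 - t\<^sup>2) powr (\<alpha> - real (Suc (Suc k)))"
    using kernel_functional_bound [OF k'] by blast
  define N where "N = Suc k"
  define L where "L = max K1 K2"
  define s where "s = sqrt (2 / C)"
  define K where "K = L * (1 + 2 ^ N * (3 + 2 * s))"
  have L: "L > 0" "K1 \<le> L" "K2 \<le> L" and s: "s > 0" "s\<^sup>2 = 2 / C"
    using K1 C by (auto simp: L_def s_def)
  have LK: "L \<le> K"
    using L s by (simp add: K_def)
  show ?thesis
  proof (rule that [of K])
    show "K > 0"
      using L LK by linarith
    fix p q :: "complex ^ 'n" and U V A
    assume p: "norm p < 1" and q: "norm q < 1" and A: "A \<ge> 0"
      and mc: "monomial_control \<alpha> A p q U V"
      and cond: "p \<noteq> q \<Longrightarrow> C * norm (1 - hinner p (Phi p q /\<^sub>R norm (Phi p q))) \<le> 1 - (norm p)\<^sup>2"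
    define d e where "d = 1 - (norm p)\<^sup>2" and "e = 1 - (norm q)\<^sup>2"
    define D where "D = 1 - hinner q p"
    define r where "r = norm (Phi p q)"
    define E where "E = norm (q - p)"
    define X where "X = norm (hinner (q - p) p)"
    define W where "W = V / D ^ N"
    define \<epsilon> where "\<epsilon> = A * L * d powr (\<alpha> - real N)"
    have d: "d > 0" "e > 0"
      using p q by (simp_all add: d_def e_def power_less_one_iff)
    have "d \<le> 2 * norm D"
      using one_minus_hinner_lower [OF p q] by (simp only: D_def d_def)
    then have D0: "norm D > 0"
      using d by linarith
    have hp: "norm (hinner x y) < 1" if "norm x < 1" "norm y < 1" for x y :: "complex ^ 'n"
      using norm_hinner_le [of x y] that
      by (smt (verit) mult_left_le norm_ge_zero)
    have dD: "1 - hinner p p = of_real d"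
      by (simp add: hinner_self d_def)
    have X_eq: "X = norm (of_real d - D)"
      by (simp add: X_def d_def D_def hinner_diff_left hinner_self)
    have rho: "r\<^sup>2 * (norm D)\<^sup>2 = X\<^sup>2 + d * E\<^sup>2"
      unfolding r_def D_def X_def d_def E_def using D0 p
      by (intro norm_Phi) (auto simp: D_def)
    have r0: "r \<ge> 0" and E0: "E \<ge> 0" and X0: "X \<ge> 0"
      by (simp_all add: r_def E_def X_def)
    have \<epsilon>0: "\<epsilon> \<ge> 0"
      using A L by (simp add: \<epsilon>_def)
    have mc1: "norm (U * hinner p w ^ j - V * hinner q w ^ j)
        \<le> A * real (j + 1) powr - \<alpha> * norm w ^ j" for j w
      using mc by (simp add: monomial_control_def)
    have mc2: "norm (U * hinner p w ^ j * hinner p \<eta> - V * hinner q w ^ j * hinner q \<eta>)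
        \<le> A * real (j + 1) powr - \<alpha> * norm w ^ j * norm \<eta>" for j w \<eta>
      using mc by (simp add: monomial_control_def)

    \<comment> \<open>The values of the functional on the three kernels.\<close>
    define a where "a = U / of_real d ^ N - W"
    define b where "b = U / of_real d ^ Suc N - V / D ^ Suc N"
    define c where "c = U * hinner p (p - q) / of_real d ^ Suc N
        - V * hinner q (p - q) / D ^ Suc N"
    have na: "norm a \<le> \<epsilon>"
    proof -
      have "norm a \<le> A * K1 * d powr (\<alpha> - real N)"
        unfolding a_def W_def d_def D_def N_def
        using bd1 [OF norm_ge_zero p A hp [OF p p] hp [OF q p] mc1] dD by (simp add: d_def)
      also have "\<dots> \<le> \<epsilon>"
        unfolding \<epsilon>_def using A L by (intro mult_right_mono mult_left_mono) auto
      finally show ?thesis .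
    qed
    have K2_le: "B * K2 * d powr (\<alpha> - real (Suc N)) \<le> (B * L * d powr (\<alpha> - real N)) / d"
      if "B \<ge> 0" for B
    proof -
      have "d powr (\<alpha> - real (Suc N)) = d powr (\<alpha> - real N) / d"
        using d by (simp add: powr_diff powr_add field_simps)
      then show ?thesis
        using that L d by (simp add: divide_right_mono mult_left_mono mult_right_mono)
    qed
    have nb: "norm b \<le> \<epsilon> / d"
    proof -
      have "norm b \<le> A * K2 * d powr (\<alpha> - real (Suc N))"
        unfolding b_def d_def D_def N_def
        using bd2 [OF norm_ge_zero p A hp [OF p p] hp [OF q p] mc1] dD by (simp add: d_def)
      also have "\<dots> \<le> \<epsilon> / d"
        using K2_le [OF A] by (simp add: \<epsilon>_def)
      finally show ?thesis .
    qed
    have nc: "norm c \<le> \<epsilon> * E / d"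
    proof -
      have AE: "A * E \<ge> 0"
        using A E0 by simp
      have *: "norm (U * hinner p (p - q) * hinner p p ^ j - V * hinner q (p - q) * hinner q p ^ j)
          \<le> A * E * real (j + 1) powr - \<alpha> * norm p ^ j" for j
        using mc2 [of p j "p - q"] by (simp add: E_def norm_minus_commute mult_ac)
      have "norm c \<le> A * E * K2 * d powr (\<alpha> - real (Suc N))"
        unfolding c_def d_def D_def N_def
        using bd2 [OF norm_ge_zero p AE hp [OF p p] hp [OF q p] *] dD by (simp add: d_def)
      also have "\<dots> \<le> (A * E * L * d powr (\<alpha> - real N)) / d"
        by (rule K2_le [OF AE])
      finally show ?thesis
        by (simp add: \<epsilon>_def mult_ac)
    qed

    have WX: "norm W * X \<le> 2 * \<epsilon> * norm D"
    proof -
      have "W * (of_real d - D) / D = a - of_real d * b"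
        using d D0 by (simp add: a_def b_def W_def field_simps)
      then have "norm W * X / norm D \<le> norm a + norm (of_real d * b)"
        unfolding X_eq by (metis norm_triangle_ineq4 norm_mult norm_divide)
      also have "norm (of_real d * b) \<le> \<epsilon>"
        using nb d by (simp add: norm_mult field_simps)
      finally have "norm W * X / norm D \<le> 2 * \<epsilon>"
        using na by simp
      then show ?thesis
        using D0 by (simp add: field_simps)
    qed
    have WE: "norm W * (d * E) \<le> 2 * \<epsilon> * norm D"
    proof (cases "E = 0")
      case True
      then show ?thesis
        using \<epsilon>0 by simp
    next
      case False
      have "hinner p (p - q) - hinner q (p - q) = of_real (E\<^sup>2)"
        unfolding E_def by (metis hinner_diff_left hinner_self norm_minus_commute)
      then have hq: "hinner q (p - q) = hinner p (p - q) - of_real (E\<^sup>2)"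
        by (simp add: algebra_simps)
      have "W / D * of_real (E\<^sup>2) = c - hinner p (p - q) * b"
        unfolding c_def b_def W_def hq using d D0 by (simp add: field_simps)
      then have "norm W / norm D * E\<^sup>2 \<le> norm c + norm (hinner p (p - q) * b)"
        using norm_triangle_ineq4 [of c "hinner p (p - q) * b"]
        by (metis norm_divide norm_mult norm_of_real abs_power2)
      also have "norm (hinner p (p - q) * b) \<le> E * (\<epsilon> / d)"
      proof -
        have "norm (hinner p (p - q)) \<le> norm p * E"
          using norm_hinner_le [of p "p - q"] by (simp add: E_def norm_minus_commute)
        also have "\<dots> \<le> E"
          using p E0 by (simp add: mult_right_le_one_le mult.commute)
        finally show ?thesis
          unfolding norm_mult using nb E0 by (intro mult_mono) auto
      qed
      also have "norm c \<le> E * (\<epsilon> / d)"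
        using nc by (simp add: mult.commute)
      finally have "norm W / norm D * E\<^sup>2 \<le> 2 * (E * (\<epsilon> / d))"
        by simp
      then have "(norm W * (d * E)) * E \<le> (2 * \<epsilon> * norm D) * E"
        using d D0 by (simp add: field_simps power2_eq_square)
      then show ?thesis
        using False E0 by simp
    qed

    have X_le: "X \<le> r * norm D"
    proof -
      have "X\<^sup>2 \<le> (r * norm D)\<^sup>2"
        using rho d by (simp add: power_mult_distrib)
      then show ?thesis
        by (rule power2_le_imp_le) (use r0 in simp)
    qed
    \<comment> \<open>With \<open>\<xi> = Phi p q / r\<close> one has \<open>\<bar>\<langle>p,\<xi>\<rangle>\<bar> = X / (r \<bar>D\<bar>)\<close>, which the infimum condition bounds from
      below by \<open>1 - d / C\<close>; then \<open>rho\<close> leaves little room for \<open>E\<close>.\<close>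
    have E_le: "E \<le> s * (r * norm D)"
    proof (cases "p = q")
      case True
      then show ?thesis
        using s r0 by (simp add: E_def)
    next
      case False
      then have "E > 0"
        by (simp add: E_def)
      then have "r\<^sup>2 * (norm D)\<^sup>2 > 0"
        unfolding rho using d by (intro add_nonneg_pos) auto
      then have r: "r > 0"
        using r0 by (cases "r = 0") auto
      have "norm (hinner p (Phi p q)) = norm (hinner (Phi p q) p)"
        by (metis cnj_hinner complex_mod_cnj)
      also have "\<dots> = X / norm D"
        unfolding X_def D_def using D0
        by (subst hinner_Phi) (auto simp: D_def norm_divide norm_minus_commute hinner_diff_left)
      finally have "norm (hinner p (Phi p q /\<^sub>R r)) = X / norm D / r"
        using r by (simp add: hinner_scaleR_right norm_mult norm_inverse divide_inverse
            mult.commute)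
      then have "1 - X / norm D / r \<le> norm (1 - hinner p (Phi p q /\<^sub>R r))"
        by (metis norm_one norm_triangle_ineq2)
      also have "\<dots> \<le> d / C"
        using cond [OF False] C by (simp add: r_def d_def field_simps)
      finally have "r * norm D - X \<le> d / C * (r * norm D)"
        using r D0 by (simp add: field_simps)
      then have "(r * norm D - X) * (r * norm D + X)
          \<le> d / C * (r * norm D) * (2 * (r * norm D))"
        using X_le X0 r0 d C by (intro mult_mono) auto
      also have "(r * norm D - X) * (r * norm D + X) = d * E\<^sup>2"
        using rho by (simp add: power2_eq_square algebra_simps)
      also have "d / C * (r * norm D) * (2 * (r * norm D)) = d * (s\<^sup>2 * (r * norm D)\<^sup>2)"
        unfolding s(2) by (simp add: power2_eq_square)
      finally have "d * E\<^sup>2 \<le> d * (s\<^sup>2 * (r * norm D)\<^sup>2)" .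
      then have "E\<^sup>2 \<le> (s * (r * norm D))\<^sup>2"
        using d by (simp add: power_mult_distrib)
      then show ?thesis
        by (rule power2_le_imp_le) (use r0 s in simp)
    qed
    have Wr: "norm W * r \<le> 2 * \<epsilon> * (1 + s)"
    proof (cases "r = 0")
      case True
      then show ?thesis
        using \<epsilon>0 s by simp
    next
      case False
      have "norm W * r * (r * (norm D)\<^sup>2) = norm W * (r\<^sup>2 * (norm D)\<^sup>2)"
        by (simp add: power2_eq_square)
      also have "\<dots> = norm W * X * X + norm W * (d * E) * E"
        unfolding rho by (simp add: power2_eq_square algebra_simps)
      also have "\<dots> \<le> 2 * \<epsilon> * norm D * (r * norm D) + 2 * \<epsilon> * norm D * (s * (r * norm D))"
        using X0 E0 \<epsilon>0 by (intro add_mono mult_mono [OF WX X_le] mult_mono [OF WE E_le]) auto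
      also have "\<dots> = 2 * \<epsilon> * (1 + s) * (r * (norm D)\<^sup>2)"
        by (simp add: power2_eq_square algebra_simps)
      finally show ?thesis
        using False r0 D0 by simp
    qed
    have r1: "r \<le> 1"
    proof -
      have "r\<^sup>2 * (norm D)\<^sup>2 = (norm D)\<^sup>2 - d * e"
        using defect_eq [of q p] rho by (simp add: D_def X_def E_def d_def e_def)
      then have "r\<^sup>2 * (norm D)\<^sup>2 \<le> 1 * (norm D)\<^sup>2"
        using d by simp
      then have "r\<^sup>2 \<le> 1"
        using D0 by simp
      then show ?thesis
        using r0 by (simp add: power_le_one_iff)
    qed
    \<comment> \<open>The first kernel transfers the bound from \<open>W\<close> to \<open>U\<close>, since \<open>r \<le> 1\<close>.\<close>
    have Ur: "norm U * r \<le> A * L * (3 + 2 * s) * d powr \<alpha>"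
    proof -
      have "norm (U / of_real d ^ N) \<le> norm a + norm W"
        using norm_triangle_ineq [of a W] by (simp add: a_def)
      then have "norm (U / of_real d ^ N) * r \<le> (norm a + norm W) * r"
        using r0 by (intro mult_right_mono)
      also have "\<dots> \<le> \<epsilon> * 1 + 2 * \<epsilon> * (1 + s)"
        unfolding distrib_right using r0 \<epsilon>0
        by (intro add_mono mult_mono [OF na r1] Wr) auto
      also have "\<dots> = \<epsilon> * (3 + 2 * s)"
        by (simp add: algebra_simps)
      finally have "norm U * r \<le> \<epsilon> * (3 + 2 * s) * d ^ N"
        using d by (simp add: norm_divide norm_power field_simps)
      also have "d ^ N = d powr real N"
        using d by (simp add: powr_realpow)
      also have "\<epsilon> * (3 + 2 * s) * d powr real N = A * L * (3 + 2 * s) * (d powr (\<alpha> - real N) * d powr real N)"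
        by (simp add: \<epsilon>_def)
      also have "d powr (\<alpha> - real N) * d powr real N = d powr \<alpha>"
        by (simp flip: powr_add)
      finally show ?thesis .
    qed

    \<comment> \<open>The kernel centred at \<open>q\<close> transfers the bound from \<open>U\<close> to \<open>V\<close>.\<close>
    have "norm V * r \<le> K * A * e powr \<alpha>"
    proof -
      have mc1': "norm (V * hinner q q ^ j - U * hinner p q ^ j)
          \<le> A * real (j + 1) powr - \<alpha> * norm q ^ j" for j
        using mc1 [where w = q and j = j] by (simp add: norm_minus_commute)
      have De: "norm (1 - hinner p q) = norm D" "1 - hinner q q = of_real e"
        by (simp_all add: D_def norm_one_minus_hinner_commute hinner_self e_def)
      have "norm (V / of_real e ^ N - U / (1 - hinner p q) ^ N) \<le> A * K1 * e powr (\<alpha> - real N)"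
        using bd1 [OF norm_ge_zero q A hp [OF q q] hp [OF p q] mc1'] unfolding De
        by (simp add: e_def N_def)
      also have "\<dots> \<le> A * L * e powr (\<alpha> - real N)"
        using A L by (intro mult_right_mono mult_left_mono) auto
      finally have "norm (V / of_real e ^ N)
          \<le> A * L * e powr (\<alpha> - real N) + norm (U / (1 - hinner p q) ^ N)"
        by (smt (verit) norm_triangle_ineq2)
      then have "norm V \<le> (A * L * e powr (\<alpha> - real N) + norm U / norm D ^ N) * e ^ N"
        using d De by (simp add: norm_divide norm_power field_simps)
      also have "\<dots> = A * L * (e powr (\<alpha> - real N) * e powr real N) + norm U * e ^ N / norm D ^ N"
        using d by (simp add: powr_realpow algebra_simps)
      also have "e powr (\<alpha> - real N) * e powr real N = e powr \<alpha>"
        by (simp flip: powr_add)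
      finally have "norm V * r \<le> (A * L * e powr \<alpha> + norm U * e ^ N / norm D ^ N) * r"
        using r0 by (intro mult_right_mono)
      also have "\<dots> = A * L * e powr \<alpha> * r + (norm U * r) * (e ^ N / norm D ^ N)"
        by (simp add: algebra_simps)
      also have "\<dots> \<le> A * L * e powr \<alpha> * 1
          + (A * L * (3 + 2 * s) * d powr \<alpha>) * (e ^ N / norm D ^ N)"
        using A L d D0 by (intro add_mono mult_left_mono [OF r1] mult_right_mono [OF Ur]) auto
      also have "d powr \<alpha> * (e ^ N / norm D ^ N) \<le> 2 ^ N * e powr \<alpha>"
      proof -
        have "e powr (real N - \<alpha>) * d powr \<alpha> \<le> 2 ^ N * norm D ^ N"
          using weight_le_product [OF q p, of \<alpha> N] assms(1) k De
          by (simp add: d_def e_def N_def)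
        then have "e powr real N * d powr \<alpha> / norm D ^ N \<le> 2 ^ N * e powr \<alpha>"
          using d D0 by (simp add: powr_diff field_simps)
        then show ?thesis
          using d by (simp add: powr_realpow mult.commute)
      qed
      then have "(A * L * (3 + 2 * s) * d powr \<alpha>) * (e ^ N / norm D ^ N)
          \<le> A * L * (3 + 2 * s) * (2 ^ N * e powr \<alpha>)"
        using A L s mult_left_mono [of "d powr \<alpha> * (e ^ N / norm D ^ N)" _ "A * L * (3 + 2 * s)"]
        by (simp add: mult.assoc)
      finally show ?thesis
        by (simp add: K_def algebra_simps)
    qed
    moreover have "norm a \<le> K * A * d powr (\<alpha> - real N)"
    proof -
      have "\<epsilon> \<le> K * A * d powr (\<alpha> - real N)"
        unfolding \<epsilon>_def using LK A by (simp add: mult_right_mono mult_left_mono mult.commute)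
      with na show ?thesis by linarith
    qed
    ultimately show "norm (U / of_real (1 - (norm p)\<^sup>2) ^ Suc k - V / (1 - hinner q p) ^ Suc k)
             \<le> K * A * (1 - (norm p)\<^sup>2) powr (\<alpha> - real (Suc k)) \<and>
          norm V * norm (Phi p q) \<le> K * A * (1 - (norm q)\<^sup>2) powr \<alpha>"
      by (simp only: a_def W_def N_def D_def d_def e_def r_def)
  qed
qed

text \<open>
  With \<open>\<delta> = 1 - \<bar>p\<bar>\<^sup>2\<close> and \<open>D = 1 - \<langle>q,p\<rangle>\<close>, one has
  \<open>U f(p) - V f(q) = (U / \<delta>\<^sup>N - V / D\<^sup>N) \<delta>\<^sup>N f(p) + V (\<delta>\<^sup>N f(p) / D\<^sup>N - f(q))\<close>, and the two terms are
  bounded by the two parts of the preceding lemma, the second one through the Lipschitz estimate.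
\<close>

lemma two_point_functional_bound:
  fixes \<alpha> C :: real
  assumes \<alpha>: "0 < \<alpha>" and C: "C > 0"
  obtains K where "K > 0"
    "\<And>(p :: complex ^ 'n) q U V A f M.
      \<lbrakk>norm p < 1; norm q < 1; A \<ge> 0; monomial_control \<alpha> A p q U V;
       p \<noteq> q \<Longrightarrow> C * norm (1 - hinner p (Phi p q /\<^sub>R norm (Phi p q))) \<le> 1 - (norm p)\<^sup>2;
       holomorphic_fun_on f (ball 0 1);
       \<And>z. norm z < 1 \<Longrightarrow> norm (f z) \<le> M * (1 - (norm z)\<^sup>2) powr - \<alpha>; M \<ge> 0\<rbrakk>
      \<Longrightarrow> norm (U * f p - V * f q) \<le> K * A * M"
proof -
  obtain k where k: "\<alpha> \<le> real k"
    using real_arch_simple by blast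
  define N where "N = Suc k"
  obtain K1 where K1: "K1 > 0" and bd1: "\<And>(p :: complex ^ 'n) q U V A.
      \<lbrakk>norm p < 1; norm q < 1; A \<ge> 0; monomial_control \<alpha> A p q U V;
       p \<noteq> q \<Longrightarrow> C * norm (1 - hinner p (Phi p q /\<^sub>R norm (Phi p q))) \<le> 1 - (norm p)\<^sup>2\<rbrakk>
      \<Longrightarrow> norm (U / of_real (1 - (norm p)\<^sup>2) ^ N - V / (1 - hinner q p) ^ N)
             \<le> K1 * A * (1 - (norm p)\<^sup>2) powr (\<alpha> - real N) \<and>
          norm V * norm (Phi p q) \<le> K1 * A * (1 - (norm q)\<^sup>2) powr \<alpha>"
    unfolding N_def using test_kernel_consequences [OF \<alpha> k C, where 'n = 'n] by blast
  have N: "\<alpha> \<le> real N"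
    using k by (simp add: N_def)
  obtain K2 where K2: "K2 > 0" and bd2: "\<And>(p :: complex ^ 'n) q r f M.
      \<lbrakk>norm p < 1; norm q < 1; r \<ge> 0;
       r\<^sup>2 * (norm (1 - hinner q p))\<^sup>2 =
           (norm (hinner (q - p) p))\<^sup>2 + (1 - (norm p)\<^sup>2) * (norm (q - p))\<^sup>2;
       holomorphic_fun_on f (ball 0 1);
       \<And>z. norm z < 1 \<Longrightarrow> norm (f z) \<le> M * (1 - (norm z)\<^sup>2) powr - \<alpha>; M \<ge> 0\<rbrakk>
      \<Longrightarrow> norm (of_real (1 - (norm p)\<^sup>2) ^ N * f p / (1 - hinner q p) ^ N - f q)
            \<le> K2 * r * (1 - (norm q)\<^sup>2) powr - \<alpha> * M"
    using test_function_Lipschitz [OF \<alpha> N, where 'n = 'n] by blast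
  show ?thesis
  proof (rule that [of "K1 * (1 + K2)"])
    show "K1 * (1 + K2) > 0"
      using K1 K2 by simp
    fix p q :: "complex ^ 'n" and U V A M and f :: "complex ^ 'n \<Rightarrow> complex"
    assume p: "norm p < 1" and q: "norm q < 1" and A: "A \<ge> 0"
      and mc: "monomial_control \<alpha> A p q U V"
      and cond: "p \<noteq> q \<Longrightarrow> C * norm (1 - hinner p (Phi p q /\<^sub>R norm (Phi p q))) \<le> 1 - (norm p)\<^sup>2"
      and f: "holomorphic_fun_on f (ball 0 1)"
      and fM: "\<And>z. norm z < 1 \<Longrightarrow> norm (f z) \<le> M * (1 - (norm z)\<^sup>2) powr - \<alpha>"
      and M: "M \<ge> 0"
    define d e where "d = 1 - (norm p)\<^sup>2" and "e = 1 - (norm q)\<^sup>2"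
    define D where "D = 1 - hinner q p"
    define r where "r = norm (Phi p q)"
    have d: "d > 0" "e > 0"
      using p q by (simp_all add: d_def e_def power_less_one_iff)
    have "d \<le> 2 * norm D"
      using one_minus_hinner_lower [OF p q] by (simp only: D_def d_def)
    then have D0: "D \<noteq> 0"
      using d by auto
    have "norm (U / of_real d ^ N - V / D ^ N) \<le> K1 * A * d powr (\<alpha> - real N) \<and>
        norm V * r \<le> K1 * A * e powr \<alpha>"
      unfolding d_def e_def D_def r_def by (rule bd1 [OF p q A mc]) (rule cond)
    then have 1: "norm (U / of_real d ^ N - V / D ^ N) \<le> K1 * A * d powr (\<alpha> - real N)"
      and 2: "norm V * r \<le> K1 * A * e powr \<alpha>"
      by blast+
    have 3: "norm (of_real d ^ N * f p / D ^ N - f q) \<le> K2 * r * e powr - \<alpha> * M"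
      unfolding d_def e_def D_def r_def using D0
      by (intro bd2 [OF p q norm_ge_zero norm_Phi [OF p] f fM M]) (auto simp: D_def)
    have "U * f p - V * f q = (U / of_real d ^ N - V / D ^ N) * (of_real d ^ N * f p)
        + V * (of_real d ^ N * f p / D ^ N - f q)"
      using d D0 by (simp add: field_simps)
    then have "norm (U * f p - V * f q)
        \<le> norm (U / of_real d ^ N - V / D ^ N) * norm (of_real d ^ N * f p)
        + norm V * norm (of_real d ^ N * f p / D ^ N - f q)"
      by (metis norm_triangle_ineq norm_mult)
    also have "\<dots> \<le> K1 * A * d powr (\<alpha> - real N) * (d powr real N * (M * d powr - \<alpha>))
        + norm V * (K2 * r * e powr - \<alpha> * M)"
    proof (intro add_mono mult_mono 1 3)
      show "norm (of_real d ^ N * f p) \<le> d powr real N * (M * d powr - \<alpha>)"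
        using mult_left_mono [OF fM [OF p], of "d ^ N"] d
        by (simp add: norm_mult norm_power powr_realpow flip: d_def)
    qed (use A K1 in auto)
    also have "K1 * A * d powr (\<alpha> - real N) * (d powr real N * (M * d powr - \<alpha>)) = K1 * A * M"
      using d by (simp add: powr_diff powr_minus_divide)
    also have "norm V * (K2 * r * e powr - \<alpha> * M) = K2 * e powr - \<alpha> * M * (norm V * r)"
      by simp
    also have "\<dots> \<le> K2 * e powr - \<alpha> * M * (K1 * A * e powr \<alpha>)"
      using 2 K2 M by (intro mult_left_mono) auto
    also have "\<dots> = K2 * K1 * A * M"
      using d by (simp add: powr_minus_divide)
    finally show "norm (U * f p - V * f q) \<le> K1 * (1 + K2) * A * M"
      by (simp add: algebra_simps)
  qed
qed

section \<open>Weighted norms and the operator\<close>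

lemma holomorphic_fun_on_mult:
  assumes "holomorphic_fun_on f S" "holomorphic_fun_on g S"
  shows "holomorphic_fun_on (\<lambda>z. f z * g z) S"
  unfolding holomorphic_fun_on_def
proof
  fix z assume "z \<in> S"
  then obtain D E where
    "(f has_derivative D) (at z)" "\<And>c h. D (c *s h) = c * D h"
    "(g has_derivative E) (at z)" "\<And>c h. E (c *s h) = c * E h"
    using assms unfolding holomorphic_fun_on_def by meson
  then show "\<exists>F. ((\<lambda>z. f z * g z) has_derivative F) (at z) \<and> (\<forall>c h. F (c *s h) = c * F h)"
    by (intro exI [of _ "\<lambda>h. f z * E h + D h * g z"] conjI has_derivative_mult)
      (simp_all add: algebra_simps)
qed

lemma holomorphic_fun_on_diff:
  assumes "holomorphic_fun_on f S" "holomorphic_fun_on g S"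
  shows "holomorphic_fun_on (\<lambda>z. f z - g z) S"
  unfolding holomorphic_fun_on_def
proof
  fix z assume "z \<in> S"
  then obtain D E where
    "(f has_derivative D) (at z)" "\<And>c h. D (c *s h) = c * D h"
    "(g has_derivative E) (at z)" "\<And>c h. E (c *s h) = c * E h"
    using assms unfolding holomorphic_fun_on_def by meson
  then show "\<exists>F. ((\<lambda>z. f z - g z) has_derivative F) (at z) \<and> (\<forall>c h. F (c *s h) = c * F h)"
    by (intro exI [of _ "\<lambda>h. D h - E h"] conjI has_derivative_diff)
      (simp_all add: algebra_simps)
qed

lemma holomorphic_fun_on_compose:
  assumes "holomorphic_map_on \<phi> S" "\<phi> ` S \<subseteq> T" "holomorphic_fun_on f T"
  shows "holomorphic_fun_on (\<lambda>z. f (\<phi> z)) S"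
  unfolding holomorphic_fun_on_def
proof
  fix z assume "z \<in> S"
  then have "\<phi> z \<in> T"
    using assms(2) by blast
  with \<open>z \<in> S\<close> obtain D E where
    D: "(\<phi> has_derivative D) (at z)" "\<And>c h. D (c *s h) = c *s D h" and
    E: "(f has_derivative E) (at (\<phi> z))" "\<And>c h. E (c *s h) = c * E h"
    using assms unfolding holomorphic_fun_on_def holomorphic_map_on_def by meson
  from has_derivative_compose [OF D(1) E(1)]
  show "\<exists>F. ((\<lambda>z. f (\<phi> z)) has_derivative F) (at z) \<and> (\<forall>c h. F (c *s h) = c * F h)"
    by (intro exI [of _ "\<lambda>h. E (D h)"]) (simp add: D(2) E(2))
qed

lemma holomorphic_fun_on_hinner: "holomorphic_fun_on (\<lambda>z. hinner z w) S"
proof -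
  have "((\<lambda>z. hinner z w) has_derivative (\<lambda>h. hinner h w)) (at z)" for z
    unfolding hinner_def
    by (intro has_derivative_sum has_derivative_mult_left
        bounded_linear_imp_has_derivative bounded_linear_vec_nth)
  then show ?thesis
    unfolding holomorphic_fun_on_def using hinner_smult_left by blast
qed

lemma holomorphic_fun_on_hinner_power: "holomorphic_fun_on (\<lambda>z. hinner z w ^ j) S"
proof (induction j)
  case 0
  show ?case
    unfolding holomorphic_fun_on_def
    by (intro ballI exI [of _ "\<lambda>h. 0"]) simp
next
  case (Suc j)
  then show ?case
    by (simp add: holomorphic_fun_on_mult holomorphic_fun_on_hinner)
qed

lemma Hnorm_leI:
  assumes "\<And>z. norm z < 1 \<Longrightarrow> (1 - (norm z)\<^sup>2) powr \<gamma> * norm (f z) \<le> c"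
  shows "Hnorm \<gamma> f \<le> ennreal c"
  unfolding Hnorm_def using assms by (intro SUP_least ennreal_leI) auto

lemma Hnorm_pointwise:
  assumes "Hnorm \<gamma> f \<le> ennreal c" "c \<ge> 0" "norm z < 1"
  shows "(1 - (norm z)\<^sup>2) powr \<gamma> * norm (f z) \<le> c"
proof -
  have "ennreal ((1 - (norm z)\<^sup>2) powr \<gamma> * norm (f z)) \<le> Hnorm \<gamma> f"
    unfolding Hnorm_def using assms(3) by (intro SUP_upper) auto
  also have "\<dots> \<le> ennreal c"
    by (rule assms(1))
  finally show ?thesis
    using assms(2) by simp
qed

lemma Hnorm_monomial_le:
  fixes \<alpha> :: real
  assumes "\<alpha> > 0"
  obtains K where "K > 0"
    "\<And>j \<xi>. norm \<xi> = 1 \<Longrightarrow>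
       Hnorm \<alpha> (\<lambda>z :: complex ^ 'n. hinner z \<xi> ^ j) \<le> ennreal (K * real (j + 1) powr - \<alpha>)"
    "\<And>j \<xi> \<xi>'. norm \<xi> = 1 \<Longrightarrow> norm \<xi>' = 1 \<Longrightarrow>
       Hnorm \<alpha> (\<lambda>z :: complex ^ 'n. hinner z \<xi> ^ j * hinner z \<xi>')
         \<le> ennreal (K * real (j + 1) powr - \<alpha>)"
proof -
  obtain K where K: "K > 0"
    "\<And>(j::nat) x. \<lbrakk>0 \<le> x; x \<le> 1\<rbrakk> \<Longrightarrow> real (j + 1) powr \<alpha> * (1 - x) powr \<alpha> * x ^ j \<le> K"
    using power_weight_bound [of \<alpha>] assms by auto
  have 1: "(1 - (norm z)\<^sup>2) powr \<alpha> * norm (hinner z \<xi> ^ j)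
      \<le> 2 powr \<alpha> * K * real (j + 1) powr - \<alpha>"
    if "norm \<xi> = 1" "norm z < 1" for z \<xi> :: "complex ^ 'n" and j
  proof -
    have "1 - (norm z)\<^sup>2 = (1 - norm z) * (1 + norm z)"
      by (simp add: power2_eq_square algebra_simps)
    also have "\<dots> \<le> (1 - norm z) * 2"
      using that by (intro mult_left_mono) auto
    finally have "(1 - (norm z)\<^sup>2) powr \<alpha> \<le> (2 * (1 - norm z)) powr \<alpha>"
      using that assms by (intro powr_mono2) (auto simp: power_le_one)
    also have "\<dots> = 2 powr \<alpha> * (1 - norm z) powr \<alpha>"
      by (rule powr_mult)
    finally have 1: "(1 - (norm z)\<^sup>2) powr \<alpha> \<le> 2 powr \<alpha> * (1 - norm z) powr \<alpha>" .
    have "norm (hinner z \<xi> ^ j) \<le> norm z ^ j"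
      unfolding norm_power using norm_hinner_le [of z \<xi>] that by (intro power_mono) auto
    with 1 have "(1 - (norm z)\<^sup>2) powr \<alpha> * norm (hinner z \<xi> ^ j)
        \<le> (2 powr \<alpha> * (1 - norm z) powr \<alpha>) * norm z ^ j"
      by (intro mult_mono) auto
    also have "(1 - norm z) powr \<alpha> * norm z ^ j \<le> K * real (j + 1) powr - \<alpha>"
      using K(2) [of "norm z" j] that by (simp add: powr_minus field_simps)
    then have "(2 powr \<alpha> * (1 - norm z) powr \<alpha>) * norm z ^ j
        \<le> 2 powr \<alpha> * K * real (j + 1) powr - \<alpha>"
      by (simp add: mult.assoc)
    finally show ?thesis .
  qed
  show ?thesis
  proof (rule that [of "2 powr \<alpha> * K"])
    show "2 powr \<alpha> * K > 0"
      using K by simp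
    show "Hnorm \<alpha> (\<lambda>z :: complex ^ 'n. hinner z \<xi> ^ j)
        \<le> ennreal (2 powr \<alpha> * K * real (j + 1) powr - \<alpha>)" if "norm \<xi> = 1" for j \<xi>
      using 1 that by (intro Hnorm_leI)
    show "Hnorm \<alpha> (\<lambda>z :: complex ^ 'n. hinner z \<xi> ^ j * hinner z \<xi>')
        \<le> ennreal (2 powr \<alpha> * K * real (j + 1) powr - \<alpha>)"
      if "norm \<xi> = 1" "norm \<xi>' = 1" for j \<xi> \<xi>'
    proof (rule Hnorm_leI)
      fix z :: "complex ^ 'n" assume z: "norm z < 1"
      have "norm (hinner z \<xi>') \<le> 1"
        using norm_hinner_le [of z \<xi>'] that z by simp
      then have "(1 - (norm z)\<^sup>2) powr \<alpha> * norm (hinner z \<xi> ^ j) * norm (hinner z \<xi>')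
          \<le> (1 - (norm z)\<^sup>2) powr \<alpha> * norm (hinner z \<xi> ^ j) * 1"
        by (intro mult_left_mono) auto
      then show "(1 - (norm z)\<^sup>2) powr \<alpha> * norm (hinner z \<xi> ^ j * hinner z \<xi>')
          \<le> 2 powr \<alpha> * K * real (j + 1) powr - \<alpha>"
        using 1 [OF that(1) z, of j] by (simp add: norm_mult mult.assoc)
    qed
  qed
qed

text \<open>
  In the next two lemmas, division in \<open>ennreal\<close> has \<open>a / 0 = \<infinity>\<close> for \<open>a \<noteq> 0\<close> and \<open>0 / 0 = 0\<close>, so both hold
  for a vanishing denominator as well.
\<close>

lemma ennreal_divide_le_imp_le_mult:
  fixes a b :: ennreal
  assumes "a / b \<le> ennreal S" "b < \<infinity>"
  shows "a \<le> ennreal S * b"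
proof (cases "b = 0")
  case True
  have "a / b \<noteq> top"
    using assms(1) by (metis ennreal_neq_top top_unique)
  then show ?thesis
    using True by (simp split: if_splits)
next
  case False
  then have "a = a / b * b"
    using assms(2) by (simp add: ennreal_divide_times mult_divide_eq_ennreal)
  also have "\<dots> \<le> ennreal S * b"
    using assms(1) by (intro mult_right_mono) auto
  finally show ?thesis .
qed

lemma ennreal_le_mult_imp_divide_le:
  fixes a b c :: ennreal
  assumes "a \<le> c * b" "b < \<infinity>"
  shows "a / b \<le> c"
proof (cases "b = 0")
  case True
  then show ?thesis using assms by simp
next
  case False
  have "a / b \<le> c * b / b"
    using assms(1) by (rule divide_right_mono_ennreal)
  also have "\<dots> = c"
    using assms(2) False by (simp add: mult_divide_eq_ennreal)
  finally show ?thesis .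
qed

lemma ennreal_common_real_bound:
  fixes x y :: ennreal
  assumes "x < \<infinity>" "y < \<infinity>"
  obtains S where "S \<ge> 0" "x \<le> ennreal S" "y \<le> ennreal S"
proof -
  have "max x y < \<infinity>"
    using assms by simp
  then have "max x y = ennreal (enn2real (max x y))"
    by (simp add: less_top)
  then show thesis
    by (metis that enn2real_nonneg max.cobounded1 max.cobounded2)
qed

lemma unit_vector_decomposition:
  obtains \<xi> :: "complex ^ 'n" where "norm \<xi> = 1" "w = norm w *\<^sub>R \<xi>"
proof (cases "w = 0")
  case True
  obtain \<xi> :: "complex ^ 'n" where "norm \<xi> = 1"
    using vector_choose_size [of 1] by auto
  with True show ?thesis
    by (intro that [of \<xi>]) auto
next
  case False
  then show ?thesis
    by (intro that [of "w /\<^sub>R norm w"]) auto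
qed

lemma inf_conditionD:
  assumes "inf_condition \<phi> \<psi>"
  obtains C where "C > 0"
    "\<And>a. norm a < 1 \<Longrightarrow> \<phi> a \<noteq> \<psi> a \<Longrightarrow>
       C * norm (1 - hinner (\<phi> a) (Phi (\<phi> a) (\<psi> a) /\<^sub>R norm (Phi (\<phi> a) (\<psi> a))))
         \<le> 1 - (norm (\<phi> a))\<^sup>2"
proof -
  obtain C where C: "C > 0" and
    inf: "(INF a\<in>{a \<in> ball 0 1. \<phi> a \<noteq> \<psi> a}.
      ereal ((1 - (norm (\<phi> a))\<^sup>2) / norm (1 - hinner (\<phi> a) (dirn \<phi> \<psi> a)))) > ereal C"
    using assms unfolding inf_condition_def by blast
  show ?thesis
  proof (rule that [OF C])
    fix a :: "complex ^ 'a"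
    assume "norm a < 1" "\<phi> a \<noteq> \<psi> a"
    then have "ereal C < ereal ((1 - (norm (\<phi> a))\<^sup>2) / norm (1 - hinner (\<phi> a) (dirn \<phi> \<psi> a)))"
      by (intro less_le_trans [OF inf] INF_lower) auto
    then have "C < (1 - (norm (\<phi> a))\<^sup>2) / norm (1 - hinner (\<phi> a) (dirn \<phi> \<psi> a))"
      by simp
    moreover from this C have "norm (1 - hinner (\<phi> a) (dirn \<phi> \<psi> a)) > 0"
      by (metis divide_eq_0_iff less_asym zero_less_norm_iff norm_eq_zero)
    ultimately have "C * norm (1 - hinner (\<phi> a) (dirn \<phi> \<psi> a)) \<le> 1 - (norm (\<phi> a))\<^sup>2"
      by (simp add: field_simps)
    then show "C * norm (1 - hinner (\<phi> a) (Phi (\<phi> a) (\<psi> a) /\<^sub>R norm (Phi (\<phi> a) (\<psi> a))))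
         \<le> 1 - (norm (\<phi> a))\<^sup>2"
      by (simp only: dirn_def)
  qed
qed

lemma monomial_controlI:
  fixes p q :: "complex ^ 'n"
  assumes 1: "\<And>j \<xi>. norm \<xi> = 1 \<Longrightarrow>
      norm (U * hinner p \<xi> ^ j - V * hinner q \<xi> ^ j) \<le> A * real (j + 1) powr - \<alpha>"
    and 2: "\<And>j \<xi> \<xi>'. norm \<xi> = 1 \<Longrightarrow> norm \<xi>' = 1 \<Longrightarrow>
      norm (U * hinner p \<xi> ^ j * hinner p \<xi>' - V * hinner q \<xi> ^ j * hinner q \<xi>')
        \<le> A * real (j + 1) powr - \<alpha>"
  shows "monomial_control \<alpha> A p q U V"
  unfolding monomial_control_def
proof (intro conjI allI)
  fix j and w \<eta> :: "complex ^ 'n"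
  obtain \<xi> where \<xi>: "norm \<xi> = 1" "w = norm w *\<^sub>R \<xi>"
    by (rule unit_vector_decomposition)
  obtain \<xi>' where \<xi>': "norm \<xi>' = 1" "\<eta> = norm \<eta> *\<^sub>R \<xi>'"
    by (rule unit_vector_decomposition)
  have h: "hinner x w = of_real (norm w) * hinner x \<xi>"
    "hinner x \<eta> = of_real (norm \<eta>) * hinner x \<xi>'" for x
    by (metis \<xi>(2) hinner_scaleR_right) (metis \<xi>'(2) hinner_scaleR_right)
  have "U * hinner p w ^ j - V * hinner q w ^ j
      = of_real (norm w ^ j) * (U * hinner p \<xi> ^ j - V * hinner q \<xi> ^ j)"
    by (simp add: h algebra_simps)
  then have "norm (U * hinner p w ^ j - V * hinner q w ^ j)
      = norm w ^ j * norm (U * hinner p \<xi> ^ j - V * hinner q \<xi> ^ j)"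
    by (simp only: norm_mult norm_of_real) simp
  also have "\<dots> \<le> norm w ^ j * (A * real (j + 1) powr - \<alpha>)"
    by (intro mult_left_mono 1 \<xi>) auto
  finally show "norm (U * hinner p w ^ j - V * hinner q w ^ j)
        \<le> A * real (j + 1) powr - \<alpha> * norm w ^ j"
    by (simp only: mult_ac)
  have "U * hinner p w ^ j * hinner p \<eta> - V * hinner q w ^ j * hinner q \<eta>
      = of_real (norm w ^ j * norm \<eta>)
        * (U * hinner p \<xi> ^ j * hinner p \<xi>' - V * hinner q \<xi> ^ j * hinner q \<xi>')"
    by (simp add: h algebra_simps)
  then have "norm (U * hinner p w ^ j * hinner p \<eta> - V * hinner q w ^ j * hinner q \<eta>)
      = norm w ^ j * norm \<eta>
        * norm (U * hinner p \<xi> ^ j * hinner p \<xi>' - V * hinner q \<xi> ^ j * hinner q \<xi>')"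
    by (simp only: norm_mult norm_of_real) simp
  also have "\<dots> \<le> norm w ^ j * norm \<eta> * (A * real (j + 1) powr - \<alpha>)"
    by (intro mult_left_mono 2 \<xi> \<xi>') auto
  finally show "norm (U * hinner p w ^ j * hinner p \<eta> - V * hinner q w ^ j * hinner q \<eta>)
        \<le> A * real (j + 1) powr - \<alpha> * norm w ^ j * norm \<eta>"
    by (simp only: mult_ac)
qed

lemma pointwise_bound_if_inf_condition:
  fixes \<phi> \<psi> :: "complex ^ 'n \<Rightarrow> complex ^ 'n" and U V :: "complex ^ 'n \<Rightarrow> complex"
  assumes \<alpha>: "0 < \<alpha>" and A: "A \<ge> 0"
    and \<phi>: "\<phi> ` ball 0 1 \<subseteq> ball 0 1" and \<psi>: "\<psi> ` ball 0 1 \<subseteq> ball 0 1"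
    and inf: "inf_condition \<phi> \<psi>"
    and mc: "\<forall>z\<in>ball 0 1. monomial_control \<alpha> A (\<phi> z) (\<psi> z) (U z) (V z)"
  shows "\<exists>K>0. \<forall>f M z. holomorphic_fun_on f (ball 0 1) \<longrightarrow> M \<ge> 0 \<longrightarrow>
      (\<forall>x. norm x < 1 \<longrightarrow> norm (f x) \<le> M * (1 - (norm x)\<^sup>2) powr - \<alpha>) \<longrightarrow> norm z < 1 \<longrightarrow>
      norm (U z * f (\<phi> z) - V z * f (\<psi> z)) \<le> K * M"
proof -
  obtain C where C: "C > 0" and cond: "\<And>a. norm a < 1 \<Longrightarrow> \<phi> a \<noteq> \<psi> a \<Longrightarrow>
       C * norm (1 - hinner (\<phi> a) (Phi (\<phi> a) (\<psi> a) /\<^sub>R norm (Phi (\<phi> a) (\<psi> a))))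
         \<le> 1 - (norm (\<phi> a))\<^sup>2"
    using inf_conditionD [OF inf] by blast
  obtain K where K: "K > 0" and bd: "\<And>(p :: complex ^ 'n) q U V A f M.
      \<lbrakk>norm p < 1; norm q < 1; A \<ge> 0; monomial_control \<alpha> A p q U V;
       p \<noteq> q \<Longrightarrow> C * norm (1 - hinner p (Phi p q /\<^sub>R norm (Phi p q))) \<le> 1 - (norm p)\<^sup>2;
       holomorphic_fun_on f (ball 0 1);
       \<And>z. norm z < 1 \<Longrightarrow> norm (f z) \<le> M * (1 - (norm z)\<^sup>2) powr - \<alpha>; M \<ge> 0\<rbrakk>
      \<Longrightarrow> norm (U * f p - V * f q) \<le> K * A * M"
    using two_point_functional_bound [OF \<alpha> C, where 'n = 'n] by blast
  show ?thesis
  proof (intro exI [of _ "K * A + 1"] conjI allI impI)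
    show "K * A + 1 > 0"
      using K A by (simp add: add_nonneg_pos)
    fix f :: "complex ^ 'n \<Rightarrow> complex" and M z
    assume f: "holomorphic_fun_on f (ball 0 1)" and M: "M \<ge> 0"
      and fM: "\<forall>x. norm x < 1 \<longrightarrow> norm (f x) \<le> M * (1 - (norm x)\<^sup>2) powr - \<alpha>"
      and z: "norm (z :: complex ^ 'n) < 1"
    have p: "norm (\<phi> z) < 1" and q: "norm (\<psi> z) < 1"
      and mcz: "monomial_control \<alpha> A (\<phi> z) (\<psi> z) (U z) (V z)"
      using \<phi> \<psi> mc z by (auto simp: image_subset_iff)
    have "norm (U z * f (\<phi> z) - V z * f (\<psi> z)) \<le> K * A * M"
      using fM by (intro bd [OF p q A mcz cond [OF z] f _ M]) auto
    also have "\<dots> \<le> (K * A + 1) * M"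
      using M by (simp add: distrib_right)
    finally show "norm (U z * f (\<phi> z) - V z * f (\<psi> z)) \<le> (K * A + 1) * M" .
  qed
qed

lemma bounded_HinfI:
  fixes \<phi> \<psi> :: "complex ^ 'n \<Rightarrow> complex ^ 'n" and u v :: "complex ^ 'n \<Rightarrow> complex"
  assumes u: "holomorphic_fun_on u (ball 0 1)" and v: "holomorphic_fun_on v (ball 0 1)"
    and \<phi>: "holomorphic_map_on \<phi> (ball 0 1)" "\<phi> ` ball 0 1 \<subseteq> ball 0 1"
    and \<psi>: "holomorphic_map_on \<psi> (ball 0 1)" "\<psi> ` ball 0 1 \<subseteq> ball 0 1"
    and K: "K \<ge> 0"
    and bd: "\<And>f M z. \<lbrakk>holomorphic_fun_on f (ball 0 1); M \<ge> 0;
        \<forall>x. norm x < 1 \<longrightarrow> norm (f x) \<le> M * (1 - (norm x)\<^sup>2) powr - \<alpha>; norm z < 1\<rbrakk>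
      \<Longrightarrow> (1 - (norm z)\<^sup>2) powr \<beta> * norm (u z * f (\<phi> z) - v z * f (\<psi> z)) \<le> K * M"
  shows "bounded_Hinf \<alpha> \<beta> (\<lambda>f z. wcomp u \<phi> f z - wcomp v \<psi> f z)"
proof -
  have norm_le: "Hnorm \<beta> (\<lambda>z. wcomp u \<phi> f z - wcomp v \<psi> f z) \<le> ennreal K * Hnorm \<alpha> f"
    if f: "f \<in> Hinf \<alpha>" for f
  proof -
    define M where "M = enn2real (Hnorm \<alpha> f)"
    have M: "M \<ge> 0" "Hnorm \<alpha> f = ennreal M"
      using f by (auto simp: M_def Hinf_def)
    have "norm (f x) \<le> M * (1 - (norm x)\<^sup>2) powr - \<alpha>" if "norm x < 1" for x
    proof -
      have "0 < 1 - (norm x)\<^sup>2"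
        using that by (simp add: power_less_one_iff)
      then show ?thesis
        using Hnorm_pointwise [of \<alpha> f M x] M that by (simp add: powr_minus field_simps)
    qed
    then have "Hnorm \<beta> (\<lambda>z. wcomp u \<phi> f z - wcomp v \<psi> f z) \<le> ennreal (K * M)"
      unfolding wcomp_def using f M by (intro Hnorm_leI bd) (simp_all add: Hinf_def)
    then show ?thesis
      using K M by (simp add: ennreal_mult)
  qed
  moreover have "(\<lambda>z. wcomp u \<phi> f z - wcomp v \<psi> f z) \<in> Hinf \<beta>" if f: "f \<in> Hinf \<alpha>" for f
  proof -
    have "ennreal K * Hnorm \<alpha> f < \<infinity>"
      using f by (simp add: Hinf_def ennreal_mult_less_top)
    then have "Hnorm \<beta> (\<lambda>z. wcomp u \<phi> f z - wcomp v \<psi> f z) < \<infinity>"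
      using norm_le [OF f] by (rule le_less_trans [rotated])
    moreover have "holomorphic_fun_on (\<lambda>z. wcomp u \<phi> f z - wcomp v \<psi> f z) (ball 0 1)"
      unfolding wcomp_def using f
      by (intro holomorphic_fun_on_diff holomorphic_fun_on_mult u v
          holomorphic_fun_on_compose [OF \<phi>] holomorphic_fun_on_compose [OF \<psi>])
        (simp_all add: Hinf_def)
    ultimately show ?thesis
      by (simp add: Hinf_def)
  qed
  ultimately show ?thesis
    unfolding bounded_Hinf_def using K by blast
qed

theorem theorem2p5:
  fixes \<alpha> \<beta> :: real
    and u v :: "complex ^ 'n \<Rightarrow> complex"
    and \<phi> \<psi> :: "complex ^ 'n \<Rightarrow> complex ^ 'n"
  assumes "0 < \<alpha>" and "0 < \<beta>"
    and "holomorphic_fun_on u (ball 0 1)" and "holomorphic_fun_on v (ball 0 1)"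
    and "holomorphic_map_on \<phi> (ball 0 1)" and "\<phi> ` ball 0 1 \<subseteq> ball 0 1"
    and "holomorphic_map_on \<psi> (ball 0 1)" and "\<psi> ` ball 0 1 \<subseteq> ball 0 1"
    and "inf_condition \<phi> \<psi> \<or> inf_condition \<psi> \<phi>"
  shows "bounded_Hinf \<alpha> \<beta> (\<lambda>f z. wcomp u \<phi> f z - wcomp v \<psi> f z) \<longleftrightarrow>
    (SUP j::nat. SUP \<xi>\<in>sphere 0 1.
       Hnorm \<beta> (\<lambda>z. u z * hinner (\<phi> z) \<xi> ^ j - v z * hinner (\<psi> z) \<xi> ^ j)
       / Hnorm \<alpha> (\<lambda>z :: complex ^ 'n. hinner z \<xi> ^ j)) < \<infinity> \<and>
    (SUP j::nat. SUP (\<xi>, \<xi>')\<in>sphere 0 1 \<times> sphere 0 1.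
       Hnorm \<beta> (\<lambda>z. u z * hinner (\<phi> z) \<xi> ^ j * hinner (\<phi> z) \<xi>'
                    - v z * hinner (\<psi> z) \<xi> ^ j * hinner (\<psi> z) \<xi>')
       / Hnorm \<alpha> (\<lambda>z :: complex ^ 'n. hinner z \<xi> ^ j * hinner z \<xi>')) < \<infinity>"
    (is "?bounded \<longleftrightarrow> ?S1 < \<infinity> \<and> ?S2 < \<infinity>")
proof -
  obtain K0 where K0: "K0 > 0"
    and mono1: "\<And>j \<xi>. norm \<xi> = 1 \<Longrightarrow>
       Hnorm \<alpha> (\<lambda>z :: complex ^ 'n. hinner z \<xi> ^ j) \<le> ennreal (K0 * real (j + 1) powr - \<alpha>)"
    and mono2: "\<And>j \<xi> \<xi>'. norm \<xi> = 1 \<Longrightarrow> norm \<xi>' = 1 \<Longrightarrow>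
       Hnorm \<alpha> (\<lambda>z :: complex ^ 'n. hinner z \<xi> ^ j * hinner z \<xi>')
         \<le> ennreal (K0 * real (j + 1) powr - \<alpha>)"
    using Hnorm_monomial_le [OF assms(1), where 'n = 'n] by blast
  have fin1: "Hnorm \<alpha> (\<lambda>z :: complex ^ 'n. hinner z \<xi> ^ j) < \<infinity>"
    if "norm \<xi> = 1" for \<xi> j
    using mono1 [OF that] by (rule le_less_trans) simp
  have fin2: "Hnorm \<alpha> (\<lambda>z :: complex ^ 'n. hinner z \<xi> ^ j * hinner z \<xi>') < \<infinity>"
    if "norm \<xi> = 1" "norm \<xi>' = 1" for \<xi> \<xi>' j
    using mono2 [OF that] by (rule le_less_trans) simp
  show ?thesis
  proof
    assume ?bounded
    then obtain M where M: "\<And>f. f \<in> Hinf \<alpha> \<Longrightarrow>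
        Hnorm \<beta> (\<lambda>z. wcomp u \<phi> f z - wcomp v \<psi> f z) \<le> ennreal M * Hnorm \<alpha> f"
      unfolding bounded_Hinf_def by blast
    have "?S1 \<le> ennreal M"
    proof (intro SUP_least)
      fix j and \<xi> :: "complex ^ 'n" assume "\<xi> \<in> sphere 0 1"
      then have \<xi>: "norm \<xi> = 1" by simp
      have "(\<lambda>z. hinner z \<xi> ^ j) \<in> Hinf \<alpha>"
        using fin1 [OF \<xi>] by (simp add: Hinf_def holomorphic_fun_on_hinner_power)
      from M [OF this] show "Hnorm \<beta> (\<lambda>z. u z * hinner (\<phi> z) \<xi> ^ j - v z * hinner (\<psi> z) \<xi> ^ j)
         / Hnorm \<alpha> (\<lambda>z :: complex ^ 'n. hinner z \<xi> ^ j) \<le> ennreal M"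
        unfolding wcomp_def using fin1 [OF \<xi>] by (rule ennreal_le_mult_imp_divide_le)
    qed
    moreover have "?S2 \<le> ennreal M"
    proof (intro SUP_least, clarify)
      fix j and \<xi> \<xi>' :: "complex ^ 'n" assume "\<xi> \<in> sphere 0 1" "\<xi>' \<in> sphere 0 1"
      then have \<xi>: "norm \<xi> = 1" "norm \<xi>' = 1" by simp_all
      have "(\<lambda>z. hinner z \<xi> ^ j * hinner z \<xi>') \<in> Hinf \<alpha>"
        using fin2 [OF \<xi>] by (simp add: Hinf_def holomorphic_fun_on_hinner_power
            holomorphic_fun_on_hinner holomorphic_fun_on_mult)
      from M [OF this] show "Hnorm \<beta> (\<lambda>z. u z * hinner (\<phi> z) \<xi> ^ j * hinner (\<phi> z) \<xi>'
            - v z * hinner (\<psi> z) \<xi> ^ j * hinner (\<psi> z) \<xi>')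
         / Hnorm \<alpha> (\<lambda>z :: complex ^ 'n. hinner z \<xi> ^ j * hinner z \<xi>') \<le> ennreal M"
        unfolding wcomp_def mult.assoc [symmetric] using fin2 [OF \<xi>]
        by (rule ennreal_le_mult_imp_divide_le)
    qed
    ultimately show "?S1 < \<infinity> \<and> ?S2 < \<infinity>"
      by (auto intro: le_less_trans)
  next
    assume fin: "?S1 < \<infinity> \<and> ?S2 < \<infinity>"
    obtain S where S0: "S \<ge> 0" and S1: "?S1 \<le> ennreal S" and S2: "?S2 \<le> ennreal S"
      by (rule ennreal_common_real_bound [OF conjunct1 [OF fin] conjunct2 [OF fin]])
    define A where "A = S * K0"
    have A: "A \<ge> 0"
      using S0 K0 by (simp add: A_def)
    have A_eq: "ennreal S * ennreal (K0 * real (j + 1) powr - \<alpha>)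
        = ennreal (A * real (j + 1) powr - \<alpha>)" for j
      using S0 K0 by (simp add: A_def mult.assoc flip: ennreal_mult)
    have le1: "Hnorm \<beta> (\<lambda>z. u z * hinner (\<phi> z) \<xi> ^ j - v z * hinner (\<psi> z) \<xi> ^ j)
        \<le> ennreal (A * real (j + 1) powr - \<alpha>)" if "norm \<xi> = 1" for \<xi> j
    proof -
      have "Hnorm \<beta> (\<lambda>z. u z * hinner (\<phi> z) \<xi> ^ j - v z * hinner (\<psi> z) \<xi> ^ j)
         / Hnorm \<alpha> (\<lambda>z :: complex ^ 'n. hinner z \<xi> ^ j) \<le> ennreal S"
        using that by (intro order_trans [OF _ S1] SUP_upper2 [of j] SUP_upper2 [of \<xi>]) auto
      from ennreal_divide_le_imp_le_mult [OF this fin1 [OF that]]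
      have "Hnorm \<beta> (\<lambda>z. u z * hinner (\<phi> z) \<xi> ^ j - v z * hinner (\<psi> z) \<xi> ^ j)
          \<le> ennreal S * Hnorm \<alpha> (\<lambda>z :: complex ^ 'n. hinner z \<xi> ^ j)" .
      moreover have "ennreal S * Hnorm \<alpha> (\<lambda>z :: complex ^ 'n. hinner z \<xi> ^ j)
          \<le> ennreal (A * real (j + 1) powr - \<alpha>)"
        unfolding A_eq [symmetric] by (intro mult_left_mono mono1 that) simp
      ultimately show ?thesis
        by (rule order_trans)
    qed
    have le2: "Hnorm \<beta> (\<lambda>z. u z * hinner (\<phi> z) \<xi> ^ j * hinner (\<phi> z) \<xi>'
            - v z * hinner (\<psi> z) \<xi> ^ j * hinner (\<psi> z) \<xi>')
        \<le> ennreal (A * real (j + 1) powr - \<alpha>)" if "norm \<xi> = 1" "norm \<xi>' = 1" for \<xi> \<xi>' j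
    proof -
      have "Hnorm \<beta> (\<lambda>z. u z * hinner (\<phi> z) \<xi> ^ j * hinner (\<phi> z) \<xi>'
            - v z * hinner (\<psi> z) \<xi> ^ j * hinner (\<psi> z) \<xi>')
         / Hnorm \<alpha> (\<lambda>z :: complex ^ 'n. hinner z \<xi> ^ j * hinner z \<xi>') \<le> ennreal S"
        using that
        by (intro order_trans [OF _ S2] SUP_upper2 [of j] SUP_upper2 [of "(\<xi>, \<xi>')"]) auto
      from ennreal_divide_le_imp_le_mult [OF this fin2 [OF that]]
      have "Hnorm \<beta> (\<lambda>z. u z * hinner (\<phi> z) \<xi> ^ j * hinner (\<phi> z) \<xi>'
            - v z * hinner (\<psi> z) \<xi> ^ j * hinner (\<psi> z) \<xi>')
          \<le> ennreal S * Hnorm \<alpha> (\<lambda>z :: complex ^ 'n. hinner z \<xi> ^ j * hinner z \<xi>')" .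
      moreover have "ennreal S * Hnorm \<alpha> (\<lambda>z :: complex ^ 'n. hinner z \<xi> ^ j * hinner z \<xi>')
          \<le> ennreal (A * real (j + 1) powr - \<alpha>)"
        unfolding A_eq [symmetric] by (intro mult_left_mono mono2 that) simp
      ultimately show ?thesis
        by (rule order_trans)
    qed
    define U V where "U = (\<lambda>z. of_real ((1 - (norm z)\<^sup>2) powr \<beta>) * u z)"
      and "V = (\<lambda>z. of_real ((1 - (norm z)\<^sup>2) powr \<beta>) * v z)"
    have weight: "norm (U z * a - V z * b) = (1 - (norm z)\<^sup>2) powr \<beta> * norm (u z * a - v z * b)"
      for z a b
    proof -
      have "U z * a - V z * b = of_real ((1 - (norm z)\<^sup>2) powr \<beta>) * (u z * a - v z * b)"
        by (simp add: U_def V_def algebra_simps)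
      then show ?thesis
        by (simp only: norm_mult norm_of_real) simp
    qed
    have mc: "monomial_control \<alpha> A (\<phi> z) (\<psi> z) (U z) (V z)" if "z \<in> ball 0 1" for z
    proof (rule monomial_controlI)
      have z: "norm z < 1"
        using that by simp
      fix j and \<xi> \<xi>' :: "complex ^ 'n" assume \<xi>: "norm \<xi> = 1"
      show "norm (U z * hinner (\<phi> z) \<xi> ^ j - V z * hinner (\<psi> z) \<xi> ^ j)
          \<le> A * real (j + 1) powr - \<alpha>"
        unfolding weight using A by (intro Hnorm_pointwise [OF le1 [OF \<xi>] _ z]) simp
      assume \<xi>': "norm \<xi>' = 1"
      show "norm (U z * hinner (\<phi> z) \<xi> ^ j * hinner (\<phi> z) \<xi>'
          - V z * hinner (\<psi> z) \<xi> ^ j * hinner (\<psi> z) \<xi>') \<le> A * real (j + 1) powr - \<alpha>"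
        unfolding mult.assoc weight
        using A Hnorm_pointwise [OF le2 [OF \<xi> \<xi>'] _ z] by (simp add: mult.assoc)
    qed
    have "\<exists>K>0. \<forall>f M z. holomorphic_fun_on f (ball 0 1) \<longrightarrow> M \<ge> 0 \<longrightarrow>
      (\<forall>x. norm x < 1 \<longrightarrow> norm (f x) \<le> M * (1 - (norm x)\<^sup>2) powr - \<alpha>) \<longrightarrow> norm z < 1 \<longrightarrow>
      norm (U z * f (\<phi> z) - V z * f (\<psi> z)) \<le> K * M"
      using assms(9)
    proof
      assume inf: "inf_condition \<phi> \<psi>"
      have "\<forall>z\<in>ball 0 1. monomial_control \<alpha> A (\<phi> z) (\<psi> z) (U z) (V z)"
        using mc by blast
      then show ?thesis
        by (rule pointwise_bound_if_inf_condition [OF assms(1) A assms(6,8) inf])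
    next
      assume inf: "inf_condition \<psi> \<phi>"
      have "\<forall>z\<in>ball 0 1. monomial_control \<alpha> A (\<psi> z) (\<phi> z) (V z) (U z)"
        using mc monomial_control_swap by blast
      moreover have "norm (V z * f (\<psi> z) - U z * f (\<phi> z)) = norm (U z * f (\<phi> z) - V z * f (\<psi> z))"
        for z f
        by (rule norm_minus_commute)
      ultimately show ?thesis
        using pointwise_bound_if_inf_condition [OF assms(1) A assms(8,6) inf, of V U] by simp
    qed
    then obtain K where K: "K > 0" and bd: "\<forall>f M z. holomorphic_fun_on f (ball 0 1) \<longrightarrow> M \<ge> 0 \<longrightarrow>
      (\<forall>x. norm x < 1 \<longrightarrow> norm (f x) \<le> M * (1 - (norm x)\<^sup>2) powr - \<alpha>) \<longrightarrow> norm z < 1 \<longrightarrow>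
      norm (U z * f (\<phi> z) - V z * f (\<psi> z)) \<le> K * M"
      by blast
    show ?bounded
      using bd unfolding weight
      by (intro bounded_HinfI [OF assms(3-8) less_imp_le [OF K]]) blast
  qed
qed

end
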